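(* For every integer $r\ge 1$ and every real $b\ge 1$ there are finite constants $C_{r,b}$ and $L_{r,b}$ (depending only on $r$ and $b$) such that, for every symmetric probability law $\nu$ on $\mathbb{R}$ supported on $[-b,b]$ with $\int x^2\,\nu(dx)=1$, and for every integer $N\ge 2$, the following hold. (i) For every deterministic function $A:\Sigma_N^r\to\mathbb{R}$, $$\left|\mathbb{E}_\nu\langle A\rangle-\mathbb{E}_G\langle A\rangle\right|\le C_{r,b}\,\|A\|_\infty\left(\mathbb{E}_G\langle R_{12}^2\rangle+\frac1N\right).$$ (ii) For every deterministic function $A:\Sigma_N^r\to[0,\infty)$, $$e^{-L_{r,b}}\,\mathbb{E}_G\langle A\rangle\le \mathbb{E}_\nu\langle A\rangle\le e^{L_{r,b}}\,\mathbb{E}_G\langle A\rangle.$$ The observable $A$ may depend on $N$, and its bound need not be uniform in $N$.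
   Context: For an integer $N\ge 2$ let $\Sigma_N=\{-1,1\}^N$. Given real couplings $J=(J_{ij})_{1\le i<j\le N}$, define for $\sigma\in\Sigma_N$ $$H_N^J(\sigma)=\frac1{\sqrt N}\sum_{1\le i<j\le N}J_{ij}\sigma_i\sigma_j,\qquad G_N^J(\sigma)=\frac{e^{H_N^J(\sigma)}}{\sum_{\tau\in\Sigma_N}e^{H_N^J(\tau)}}.$$ (This is the zero-field Sherrington--Kirkpatrick model at inverse temperature one.) Angle brackets $\langle\cdot\rangle$ denote expectation over independent replicas $\sigma^1,\sigma^2,\ldots$ sampled from $G_N^J$, conditional on $J$; for $A:\Sigma_N^r\to\mathbb{R}$, $\langle A\rangle$ means $\langle A(\sigma^1,\ldots,\sigma^r)\rangle$. The overlap is $R_{\ell\ell'}=N^{-1}\sum_{i=1}^N\sigma_i^\ell\sigma_i^{\ell'}$. $\mathbb{E}_G$ denotes expectation over $J$ when the $J_{ij}$, $i<j$, are independent standard Gaussians, and $\mathbb{E}_\nu$ denotes expectation over $J$ when the $J_{ij}$, $i<j$, are independent with common law $\nu$. $\|A\|_\infty=\max|A|$. *)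

theory Defs
  imports "HOL-Probability.Probability"
begin

text \<open>
  The index sets are \<open>{1..N}\<close> (sites) and \<open>{1..r}\<close> (replicas).  Since \<open>N\<close> is quantified inside
  the result, configurations are extensional functions on these sets; \<open>\<sigma> l i\<close> is the spin of
  replica \<open>l\<close> at site \<open>i\<close>.
\<close>

definition spin_configs :: "nat \<Rightarrow> (nat \<Rightarrow> real) set" where
  "spin_configs N = {1..N} \<rightarrow>\<^sub>E {-1, 1}"

definition replica_configs :: "nat \<Rightarrow> nat \<Rightarrow> (nat \<Rightarrow> nat \<Rightarrow> real) set" where
  "replica_configs N r = {1..r} \<rightarrow>\<^sub>E spin_configs N"

definition site_pairs :: "nat \<Rightarrow> (nat \<times> nat) set" where
  "site_pairs N = {(i, j). 1 \<le> i \<and> i < j \<and> j \<le> N}"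

text \<open>There is no minus sign in the Hamiltonian: the Gibbs weight is proportional to \<open>exp H\<close>.\<close>

definition sk_hamiltonian :: "nat \<Rightarrow> (nat \<times> nat \<Rightarrow> real) \<Rightarrow> (nat \<Rightarrow> real) \<Rightarrow> real" where
  "sk_hamiltonian N J \<sigma> = (1 / sqrt (real N)) * (\<Sum>(i, j)\<in>site_pairs N. J (i, j) * \<sigma> i * \<sigma> j)"

definition sk_gibbs :: "nat \<Rightarrow> (nat \<times> nat \<Rightarrow> real) \<Rightarrow> (nat \<Rightarrow> real) \<Rightarrow> real" where
  "sk_gibbs N J \<sigma> =
     exp (sk_hamiltonian N J \<sigma>) / (\<Sum>\<tau>\<in>spin_configs N. exp (sk_hamiltonian N J \<tau>))"

text \<open>Expectation of \<open>A\<close> over \<open>r\<close> independent replicas, i.e. under the \<open>r\<close>-fold product of the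
  Gibbs measure, for fixed couplings \<open>J\<close>.\<close>

definition gibbs_bracket ::
    "nat \<Rightarrow> nat \<Rightarrow> (nat \<times> nat \<Rightarrow> real) \<Rightarrow> ((nat \<Rightarrow> nat \<Rightarrow> real) \<Rightarrow> real) \<Rightarrow> real" where
  "gibbs_bracket N r J A = (\<Sum>\<sigma>\<in>replica_configs N r. A \<sigma> * (\<Prod>l\<in>{1..r}. sk_gibbs N J (\<sigma> l)))"

definition overlap :: "nat \<Rightarrow> nat \<Rightarrow> nat \<Rightarrow> (nat \<Rightarrow> nat \<Rightarrow> real) \<Rightarrow> real" where
  "overlap N l l' \<sigma> = (1 / real N) * (\<Sum>i\<in>{1..N}. \<sigma> l i * \<sigma> l' i)"

definition sup_norm :: "nat \<Rightarrow> nat \<Rightarrow> ((nat \<Rightarrow> nat \<Rightarrow> real) \<Rightarrow> real) \<Rightarrow> real" where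
  "sup_norm N r A = Max ((\<lambda>\<sigma>. \<bar>A \<sigma>\<bar>) ` replica_configs N r)"

definition std_gaussian :: "real measure" where
  "std_gaussian = density lborel (\<lambda>x. ennreal (std_normal_density x))"

text \<open>The disorder average \<open>E\<^sub>\<mu>\<langle>A\<rangle>\<close> when the couplings are independent with common law \<open>\<mu>\<close>.\<close>

definition disorder_average ::
    "real measure \<Rightarrow> nat \<Rightarrow> nat \<Rightarrow> ((nat \<Rightarrow> nat \<Rightarrow> real) \<Rightarrow> real) \<Rightarrow> real" where
  "disorder_average \<mu> N r A =
     (LINT J|(\<Pi>\<^sub>M p\<in>site_pairs N. \<mu>). gibbs_bracket N r J A)"

definition admissible_law :: "real \<Rightarrow> real measure \<Rightarrow> bool" where
  "admissible_law b \<nu> \<longleftrightarrow>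
     prob_space \<nu> \<and> sets \<nu> = sets borel \<and>
     distr \<nu> borel uminus = \<nu> \<and>
     emeasure \<nu> (- {-b..b}) = 0 \<and>
     (LINT x|\<nu>. x\<^sup>2) = 1"

end

theory Submission
  imports Defs "HOL-Computational_Algebra.Polynomial"
begin

text \<open>
  Write \<open>h = x / sqrt N\<close>, \<open>t = tanh h\<close>, let \<open>s\<close> be the product of the two spins joined by an edge
  \<open>e\<close>, and let a subscript \<open>0\<close> denote the Gibbs average with the coupling of \<open>e\<close> set to \<open>0\<close>.  Since
  \<open>s = \<plusminus>1\<close>, turning on the coupling \<open>x\<close> multiplies the weight of a replica by \<open>cosh h (1 + t s)\<close>, so
  that, with \<open>m = \<langle>s\<rangle>\<^sub>0\<close>,
  \<open>\<langle>A\<rangle>\<^sub>x = \<langle>A \<Prod>\<^sub>l (1 + t s\<^sub>l)\<rangle>\<^sub>0 / (1 + t m)^r\<close>.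
  Expanding the denominator up to an error \<open>O(t^6)\<close> gives a polynomial in \<open>t\<close> whose coefficient of
  \<open>t^k\<close> is a combination of terms \<open>\<langle>A \<Prod>\<^bsub>l\<in>S\<^esub> s\<^sub>l\<rangle>\<^sub>0 m^j\<close> with \<open>|S| + j = k\<close> (\<open>edge_expansion\<close>).
  Averaged over a symmetric law of unit variance, odd powers of \<open>t\<close> vanish, and two such laws give
  even moments of \<open>t\<close> that differ by \<open>O(N^-2)\<close>: the quadratic parts cancel
  (\<open>tanh_moment_diff_le\<close>).  Replacing the law of a single coupling therefore costs \<open>O(N^-2)\<close>, and there
  are at most \<open>N^2\<close> couplings.

  For \<open>A \<ge> 0\<close> each term is at most \<open>\<langle>A\<rangle>\<^sub>0\<close>, and \<open>\<langle>A\<rangle>\<^sub>0\<close> is at most a constant times the average of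
  \<open>\<langle>A\<rangle>\<^sub>x\<close> over \<open>x\<close>.  Each replacement thus costs a factor \<open>1 + O(N^-2)\<close>, and multiplying these
  factors gives the two-sided comparison (\<open>disorder_average_comparison\<close>).

  The additive estimate uses that every term produced by a replacement carries at least two spins
  \<open>s\<close> of the same edge: the term of degree \<open>0\<close> is the same for both laws, and those of odd degree
  vanish.  For one and the same Gibbs
  measure, summing a product of an even number \<open>k\<close> of replicas of \<open>s\<close> over all edges gives half the
  square of \<open>\<Sum>\<^sub>i \<sigma>\<^sub>i\<^sup>1 \<cdots> \<sigma>\<^sub>i\<^sup>k\<close>, up to \<open>N / 2\<close>, and the mean of this square is
  \<open>\<Sum>\<^bsub>i,j\<^esub> \<langle>\<sigma>\<^sub>i \<sigma>\<^sub>j\<rangle>^k \<le> N^2 \<langle>R\<^sub>1\<^sub>2\<^sup>2\<rangle>\<close> (\<open>edge_sum_bracket_le\<close>).  To have one Gibbs measure for all edges,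
  the couplings are not exchanged one after the other: all of them follow the mixture
  \<open>p \<nu> + (1 - p) \<gamma>\<close>, where \<open>\<gamma>\<close> is the Gaussian law, and \<open>p\<close> moves from \<open>0\<close> to \<open>1\<close>.  The average is affine in the law of each
  coupling, so its derivative in \<open>p\<close> is the sum over the edges of the effects of replacing \<open>\<gamma>\<close> by
  \<open>\<nu>\<close> at that edge (\<open>multiaffine_diagonal_derivative\<close>).  There the averages with coupling \<open>0\<close> may be
  exchanged for averages with a coupling drawn from the mixture at cost \<open>O(1/N)\<close>
  (\<open>edge_average_cavity\<close>), and the derivative is bounded by the mean of \<open>R\<^sub>1\<^sub>2\<^sup>2\<close> under the mixture plus
  \<open>1/N\<close> (\<open>interpolation_drift_le\<close>).  Finally the multiplicative comparison, applied to \<open>R\<^sub>1\<^sub>2\<^sup>2 \<ge> 0\<close>,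
  brings the mean under the mixture back to the Gaussian one.
\<close>

section \<open>Configurations and Gibbs averages\<close>

definition gibbs_mean :: "nat \<Rightarrow> (nat \<times> nat \<Rightarrow> real) \<Rightarrow> ((nat \<Rightarrow> real) \<Rightarrow> real) \<Rightarrow> real" where
  "gibbs_mean N J g = (\<Sum>\<tau>\<in>spin_configs N. g \<tau> * sk_gibbs N J \<tau>)"

definition edge_spin :: "nat \<times> nat \<Rightarrow> (nat \<Rightarrow> real) \<Rightarrow> real" where
  "edge_spin e \<sigma> = \<sigma> (fst e) * \<sigma> (snd e)"

lemma finite_spin_configs [simp]: "finite (spin_configs N)"
  unfolding spin_configs_def by (intro finite_PiE) auto

lemma spin_configs_nonempty [simp]: "spin_configs N \<noteq> {}"
  unfolding spin_configs_def by (simp add: PiE_eq_empty_iff)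

lemma finite_replica_configs [simp]: "finite (replica_configs N r)"
  unfolding replica_configs_def by (intro finite_PiE) auto

lemma replica_configs_nonempty [simp]: "replica_configs N r \<noteq> {}"
  unfolding replica_configs_def by (simp add: PiE_eq_empty_iff)

lemma finite_site_pairs [simp]: "finite (site_pairs N)"
  by (rule finite_subset[of _ "{..N} \<times> {..N}"]) (auto simp: site_pairs_def)

lemma card_site_pairs_le: "card (site_pairs N) \<le> N\<^sup>2"
proof -
  have "card (site_pairs N) \<le> card ({1..N} \<times> {1..N})"
    by (intro card_mono) (auto simp: site_pairs_def)
  then show ?thesis by (simp add: power2_eq_square)
qed

lemma replica_component:
  "\<sigma> \<in> replica_configs N r \<Longrightarrow> l \<in> {1..r} \<Longrightarrow> \<sigma> l \<in> spin_configs N"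
  unfolding replica_configs_def by (rule PiE_mem)

lemma spin_values: "\<sigma> \<in> spin_configs N \<Longrightarrow> i \<in> {1..N} \<Longrightarrow> \<sigma> i = -1 \<or> \<sigma> i = 1"
  unfolding spin_configs_def by (auto dest!: PiE_mem)

lemma edge_spin_values:
  assumes "\<sigma> \<in> spin_configs N" "e \<in> site_pairs N"
  shows "edge_spin e \<sigma> = -1 \<or> edge_spin e \<sigma> = 1"
proof -
  have "fst e \<in> {1..N}" "snd e \<in> {1..N}"
    using assms(2) by (auto simp: site_pairs_def)
  from this[THEN spin_values[OF assms(1)]] show ?thesis
    by (auto simp: edge_spin_def)
qed

lemma abs_edge_spin: "\<sigma> \<in> spin_configs N \<Longrightarrow> e \<in> site_pairs N \<Longrightarrow> \<bar>edge_spin e \<sigma>\<bar> = 1"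
  using edge_spin_values by fastforce

lemma partition_function_pos: "0 < (\<Sum>\<tau>\<in>spin_configs N. exp (sk_hamiltonian N J \<tau>))"
  by (intro sum_pos) auto

lemma sk_gibbs_pos: "0 < sk_gibbs N J \<sigma>"
  unfolding sk_gibbs_def using partition_function_pos by (intro divide_pos_pos) auto

lemma sum_sk_gibbs: "(\<Sum>\<tau>\<in>spin_configs N. sk_gibbs N J \<tau>) = 1"
  unfolding sk_gibbs_def sum_divide_distrib[symmetric]
  using partition_function_pos[of N J] by simp

lemma sum_replica_weights:
  "(\<Sum>\<sigma>\<in>replica_configs N r. \<Prod>l\<in>{1..r}. g l (\<sigma> l)) = (\<Prod>l\<in>{1..r}. \<Sum>\<tau>\<in>spin_configs N. g l \<tau>)"
  for g :: "nat \<Rightarrow> (nat \<Rightarrow> real) \<Rightarrow> real"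
  unfolding replica_configs_def by (rule prod_sum_PiE[symmetric]) auto

lemma gibbs_bracket_const: "gibbs_bracket N r J (\<lambda>_. c) = c"
proof -
  have "gibbs_bracket N r J (\<lambda>_. c)
      = c * (\<Sum>\<sigma>\<in>replica_configs N r. \<Prod>l\<in>{1..r}. sk_gibbs N J (\<sigma> l))"
    by (simp add: gibbs_bracket_def sum_distrib_left)
  also have "\<dots> = c" unfolding sum_replica_weights[of "\<lambda>_. sk_gibbs N J"] sum_sk_gibbs by simp
  finally show ?thesis .
qed

lemma gibbs_bracket_cong:
  "(\<And>\<sigma>. \<sigma> \<in> replica_configs N r \<Longrightarrow> A \<sigma> = B \<sigma>) \<Longrightarrow> gibbs_bracket N r J A = gibbs_bracket N r J B"
  unfolding gibbs_bracket_def by (intro sum.cong) auto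

lemma gibbs_bracket_mono:
  "(\<And>\<sigma>. \<sigma> \<in> replica_configs N r \<Longrightarrow> A \<sigma> \<le> B \<sigma>) \<Longrightarrow> gibbs_bracket N r J A \<le> gibbs_bracket N r J B"
  unfolding gibbs_bracket_def
  by (intro sum_mono mult_right_mono prod_nonneg) (auto intro: less_imp_le sk_gibbs_pos)

lemma gibbs_bracket_sum:
  "gibbs_bracket N r J (\<lambda>\<sigma>. \<Sum>k\<in>K. A k \<sigma>) = (\<Sum>k\<in>K. gibbs_bracket N r J (A k))"
  unfolding gibbs_bracket_def sum_distrib_right by (rule sum.swap)

lemma gibbs_bracket_cmult: "gibbs_bracket N r J (\<lambda>\<sigma>. c * A \<sigma>) = c * gibbs_bracket N r J A"
  unfolding gibbs_bracket_def by (simp add: sum_distrib_left mult.assoc)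

lemma gibbs_bracket_abs_le:
  assumes "\<And>\<sigma>. \<sigma> \<in> replica_configs N r \<Longrightarrow> \<bar>A \<sigma>\<bar> \<le> B \<sigma>"
  shows "\<bar>gibbs_bracket N r J A\<bar> \<le> gibbs_bracket N r J B"
proof -
  have 1: "A \<sigma> \<le> B \<sigma>" "- B \<sigma> \<le> A \<sigma>" if "\<sigma> \<in> replica_configs N r" for \<sigma>
    using assms[OF that] by auto
  have "gibbs_bracket N r J A \<le> gibbs_bracket N r J B" by (rule gibbs_bracket_mono) (rule 1)
  moreover have "gibbs_bracket N r J (\<lambda>\<sigma>. (-1) * B \<sigma>) \<le> gibbs_bracket N r J A"
    by (rule gibbs_bracket_mono) (use 1 in auto)
  ultimately show ?thesis unfolding gibbs_bracket_cmult by linarith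
qed

lemma gibbs_bracket_nonneg:
  assumes "\<And>\<sigma>. \<sigma> \<in> replica_configs N r \<Longrightarrow> 0 \<le> A \<sigma>"
  shows "0 \<le> gibbs_bracket N r J A"
  using gibbs_bracket_mono[of N r "\<lambda>_. 0" A J] assms gibbs_bracket_const[of N r J 0] by auto

lemma abs_le_sup_norm: "\<sigma> \<in> replica_configs N r \<Longrightarrow> \<bar>A \<sigma>\<bar> \<le> sup_norm N r A"
  unfolding sup_norm_def by (intro Max_ge) auto

lemma sup_norm_nonneg: "0 \<le> sup_norm N r A"
proof -
  obtain \<sigma> where "\<sigma> \<in> replica_configs N r" using replica_configs_nonempty by blast
  then have "\<bar>A \<sigma>\<bar> \<le> sup_norm N r A" by (rule abs_le_sup_norm)
  then show ?thesis by linarith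
qed

lemma gibbs_bracket_abs_le_const:
  assumes "\<And>\<sigma>. \<sigma> \<in> replica_configs N r \<Longrightarrow> \<bar>A \<sigma>\<bar> \<le> c"
  shows "\<bar>gibbs_bracket N r J A\<bar> \<le> c"
  using gibbs_bracket_abs_le[of N r A "\<lambda>_. c", OF assms] by (simp add: gibbs_bracket_const)

lemma gibbs_mean_abs_le:
  assumes "\<And>\<tau>. \<tau> \<in> spin_configs N \<Longrightarrow> \<bar>g \<tau>\<bar> \<le> c"
  shows "\<bar>gibbs_mean N J g\<bar> \<le> c"
proof -
  have "\<bar>gibbs_mean N J g\<bar> \<le> (\<Sum>\<tau>\<in>spin_configs N. \<bar>g \<tau> * sk_gibbs N J \<tau>\<bar>)"
    unfolding gibbs_mean_def by (rule sum_abs)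
  also have "\<dots> \<le> (\<Sum>\<tau>\<in>spin_configs N. c * sk_gibbs N J \<tau>)"
    using assms by (intro sum_mono) (auto simp: abs_mult sk_gibbs_pos less_imp_le intro!: mult_right_mono)
  also have "\<dots> = c" by (simp add: sum_distrib_left[symmetric] sum_sk_gibbs)
  finally show ?thesis .
qed

lemma sum_replica_configs_Suc:
  fixes F :: "(nat \<Rightarrow> nat \<Rightarrow> real) \<Rightarrow> real"
  shows "(\<Sum>\<sigma>\<in>replica_configs N (Suc r). F \<sigma>)
       = (\<Sum>\<sigma>\<in>replica_configs N r. \<Sum>\<tau>\<in>spin_configs N. F (\<sigma>(Suc r := \<tau>)))"
proof -
  have I: "{1..Suc r} = insert (Suc r) {1..r}" by auto
  have "(\<Sum>\<sigma>\<in>replica_configs N (Suc r). F \<sigma>)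
      = (\<Sum>(\<tau>, \<sigma>)\<in>spin_configs N \<times> replica_configs N r. F (\<sigma>(Suc r := \<tau>)))"
    unfolding replica_configs_def I PiE_insert_eq
    by (subst sum.reindex[OF inj_combinator]) (auto simp: case_prod_unfold)
  also have "\<dots> = (\<Sum>\<tau>\<in>spin_configs N. \<Sum>\<sigma>\<in>replica_configs N r. F (\<sigma>(Suc r := \<tau>)))"
    by (simp add: sum.cartesian_product)
  also have "\<dots> = (\<Sum>\<sigma>\<in>replica_configs N r. \<Sum>\<tau>\<in>spin_configs N. F (\<sigma>(Suc r := \<tau>)))"
    by (rule sum.swap)
  finally show ?thesis .
qed

text \<open>
  This is how a power of a Gibbs mean, itself a function of the couplings, becomes a bracket of a
  deterministic observable: each factor of the mean is computed in a replica of its own.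
\<close>

lemma gibbs_bracket_fresh_replicas:
  "gibbs_bracket N (r + k) J (\<lambda>\<sigma>. A (restrict \<sigma> {1..r}) * (\<Prod>l\<in>{r<..r + k}. g (\<sigma> l)))
     = gibbs_bracket N r J A * gibbs_mean N J g ^ k"
proof (induction k)
  case 0
  have "gibbs_bracket N r J (\<lambda>\<sigma>. A (restrict \<sigma> {1..r})) = gibbs_bracket N r J A"
    by (rule gibbs_bracket_cong) (simp add: replica_configs_def PiE_restrict)
  then show ?case
    by (simp only: add_0_right greaterThanAtMost_empty[OF order_refl] prod.empty mult_1_right power_0)
next
  case (Suc k)
  let ?n = "r + k"
  have step: "A (restrict (\<sigma>(Suc ?n := \<tau>)) {1..r}) * (\<Prod>l\<in>{r<..Suc ?n}. g ((\<sigma>(Suc ?n := \<tau>)) l))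
      * (\<Prod>l\<in>{1..Suc ?n}. sk_gibbs N J ((\<sigma>(Suc ?n := \<tau>)) l))
    = A (restrict \<sigma> {1..r}) * (\<Prod>l\<in>{r<..?n}. g (\<sigma> l)) * (\<Prod>l\<in>{1..?n}. sk_gibbs N J (\<sigma> l))
      * (g \<tau> * sk_gibbs N J \<tau>)" for \<sigma> \<tau>
  proof -
    have r: "restrict (\<sigma>(Suc ?n := \<tau>)) {1..r} = restrict \<sigma> {1..r}" by (auto simp: restrict_def)
    have I: "{r<..Suc ?n} = insert (Suc ?n) {r<..?n}" "{1..Suc ?n} = insert (Suc ?n) {1..?n}" by auto
    have p: "(\<Prod>l\<in>K. h ((\<sigma>(Suc ?n := \<tau>)) l)) = (\<Prod>l\<in>K. h (\<sigma> l))" if "Suc ?n \<notin> K"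
      for K and h :: "(nat \<Rightarrow> real) \<Rightarrow> real"
      using that by (intro prod.cong) auto
    show ?thesis unfolding r I by (simp add: p)
  qed
  have "gibbs_bracket N (Suc ?n) J
          (\<lambda>\<sigma>. A (restrict \<sigma> {1..r}) * (\<Prod>l\<in>{r<..Suc ?n}. g (\<sigma> l)))
      = gibbs_bracket N ?n J (\<lambda>\<sigma>. A (restrict \<sigma> {1..r}) * (\<Prod>l\<in>{r<..?n}. g (\<sigma> l)))
        * gibbs_mean N J g"
    unfolding gibbs_bracket_def sum_replica_configs_Suc step sum_distrib_left[symmetric]
      gibbs_mean_def sum_distrib_right ..
  then show ?case by (simp only: add_Suc_right Suc.IH power_Suc2 mult.assoc)
qed

lemma gibbs_bracket_prod:
  assumes "T \<subseteq> {1..r}"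
  shows "gibbs_bracket N r J (\<lambda>\<sigma>. \<Prod>l\<in>T. g (\<sigma> l)) = gibbs_mean N J g ^ card T"
proof -
  have fin: "finite T" using assms finite_subset by auto
  have "gibbs_bracket N r J (\<lambda>\<sigma>. \<Prod>l\<in>T. g (\<sigma> l))
      = (\<Sum>\<sigma>\<in>replica_configs N r. \<Prod>l\<in>{1..r}. (if l \<in> T then g (\<sigma> l) else 1) * sk_gibbs N J (\<sigma> l))"
    unfolding gibbs_bracket_def prod.distrib using assms
    by (intro sum.cong refl) (simp add: prod.inter_restrict[symmetric] Int_absorb1)
  also have "\<dots> = (\<Prod>l\<in>{1..r}. if l \<in> T then gibbs_mean N J g else 1)"
    unfolding sum_replica_weights[of "\<lambda>l \<tau>. (if l \<in> T then g \<tau> else 1) * sk_gibbs N J \<tau>"]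
    by (intro prod.cong) (auto simp: gibbs_mean_def sum_sk_gibbs)
  also have "\<dots> = gibbs_mean N J g ^ card T"
    using assms by (simp add: prod.inter_restrict[symmetric] Int_absorb1)
  finally show ?thesis .
qed

section \<open>Turning on one coupling\<close>

lemma sk_hamiltonian_upd:
  assumes "e \<in> site_pairs N"
  shows "sk_hamiltonian N (J(e := x)) \<sigma>
       = sk_hamiltonian N (J(e := 0)) \<sigma> + x / sqrt (real N) * edge_spin e \<sigma>"
proof -
  have *: "(\<Sum>p\<in>site_pairs N. (J(e := y)) p * \<sigma> (fst p) * \<sigma> (snd p))
      = y * edge_spin e \<sigma> + (\<Sum>p\<in>site_pairs N - {e}. J p * \<sigma> (fst p) * \<sigma> (snd p))" for y
    by (subst sum.remove[OF _ assms]) (auto simp: edge_spin_def mult.assoc intro!: sum.cong)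
  show ?thesis
    unfolding sk_hamiltonian_def case_prod_unfold prod.collapse * by (simp add: add_divide_distrib distrib_left)
qed

lemma exp_times_sign:
  fixes h s :: real
  assumes "s = -1 \<or> s = 1"
  shows "exp (h * s) = cosh h * (1 + tanh h * s)"
proof -
  have "cosh h * (1 + tanh h * s) = cosh h + sinh h * s"
    using cosh_real_pos[of h] by (simp add: tanh_def field_simps)
  then show ?thesis using assms by (auto simp: cosh_def sinh_def field_simps)
qed

text \<open>
  By \<open>exp_times_sign\<close> the factor \<open>cosh h\<close> is common to the weight and to the partition function and
  cancels.  In the parameter \<open>tanh h\<close> the dependence on the coupling is a quotient of affine functions.
\<close>

lemma sk_gibbs_tilt:
  assumes e: "e \<in> site_pairs N" and \<sigma>: "\<sigma> \<in> spin_configs N"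
  defines "t \<equiv> \<lambda>x. tanh (x / sqrt (real N))"
  shows "sk_gibbs N (J(e := x)) \<sigma> = sk_gibbs N (J(e := 0)) \<sigma> * (1 + t x * edge_spin e \<sigma>)
           / (1 + t x * gibbs_mean N (J(e := 0)) (edge_spin e))"
proof -
  let ?h = "x / sqrt (real N)" and ?J0 = "J(e := 0)"
  let ?w = "\<lambda>\<tau>. exp (sk_hamiltonian N ?J0 \<tau>)" and ?S = "edge_spin e"
  have w: "exp (sk_hamiltonian N (J(e := x)) \<tau>) = cosh ?h * (?w \<tau> * (1 + t x * ?S \<tau>))"
    if "\<tau> \<in> spin_configs N" for \<tau>
    unfolding sk_hamiltonian_upd[OF e, of J x] exp_add t_def
    using exp_times_sign[OF edge_spin_values[OF that e], of ?h] by simp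
  define Z where "Z = (\<Sum>\<tau>\<in>spin_configs N. ?w \<tau>)"
  have Z: "Z > 0" unfolding Z_def by (rule partition_function_pos)
  have m: "gibbs_mean N ?J0 ?S * Z = (\<Sum>\<tau>\<in>spin_configs N. ?w \<tau> * ?S \<tau>)"
    unfolding gibbs_mean_def sk_gibbs_def Z_def[symmetric] sum_distrib_right
    using Z by (intro sum.cong) auto
  have "(\<Sum>\<tau>\<in>spin_configs N. exp (sk_hamiltonian N (J(e := x)) \<tau>))
      = cosh ?h * (\<Sum>\<tau>\<in>spin_configs N. ?w \<tau> + t x * (?w \<tau> * ?S \<tau>))"
    unfolding sum_distrib_left by (intro sum.cong) (auto simp: w algebra_simps)
  also have "\<dots> = cosh ?h * (Z * (1 + t x * gibbs_mean N ?J0 ?S))"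
    unfolding sum.distrib sum_distrib_left[symmetric] m[symmetric] Z_def[symmetric]
    by (simp add: algebra_simps)
  finally have ZZ: "(\<Sum>\<tau>\<in>spin_configs N. exp (sk_hamiltonian N (J(e := x)) \<tau>))
      = cosh ?h * (Z * (1 + t x * gibbs_mean N ?J0 ?S))" .
  have "cosh ?h \<noteq> 0" using cosh_real_pos[of ?h] by simp
  then show ?thesis
    unfolding sk_gibbs_def[of N "J(e := x)"] ZZ w[OF \<sigma>]
    unfolding sk_gibbs_def Z_def[symmetric] by simp
qed

lemma abs_gibbs_mean_edge_le:
  assumes "e \<in> site_pairs N"
  shows "\<bar>gibbs_mean N J (edge_spin e)\<bar> \<le> 1"
  by (rule gibbs_mean_abs_le) (simp add: abs_edge_spin assms)

lemma gibbs_bracket_tilt: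
  assumes e: "e \<in> site_pairs N"
  defines "t \<equiv> \<lambda>x. tanh (x / sqrt (real N))"
  shows "gibbs_bracket N r (J(e := x)) A
       = gibbs_bracket N r (J(e := 0)) (\<lambda>\<sigma>. A \<sigma> * (\<Prod>l\<in>{1..r}. 1 + t x * edge_spin e (\<sigma> l)))
           / (1 + t x * gibbs_mean N (J(e := 0)) (edge_spin e)) ^ r"
proof -
  let ?D = "1 + t x * gibbs_mean N (J(e := 0)) (edge_spin e)"
  have "(\<Prod>l\<in>{1..r}. sk_gibbs N (J(e := x)) (\<sigma> l))
      = (\<Prod>l\<in>{1..r}. sk_gibbs N (J(e := 0)) (\<sigma> l)) * (\<Prod>l\<in>{1..r}. 1 + t x * edge_spin e (\<sigma> l)) / ?D ^ r"
    if "\<sigma> \<in> replica_configs N r" for \<sigma>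
  proof -
    have "(\<Prod>l\<in>{1..r}. sk_gibbs N (J(e := x)) (\<sigma> l))
      = (\<Prod>l\<in>{1..r}. sk_gibbs N (J(e := 0)) (\<sigma> l) * (1 + t x * edge_spin e (\<sigma> l)) / ?D)"
      unfolding t_def by (intro prod.cong refl sk_gibbs_tilt[OF e replica_component[OF that]])
    then show ?thesis by (simp add: prod.distrib prod_dividef)
  qed
  then show ?thesis unfolding gibbs_bracket_def sum_divide_distrib
    by (intro sum.cong) (auto simp: mult_ac)
qed

lemma gibbs_bracket_tilt_expand:
  assumes e: "e \<in> site_pairs N"
  shows "gibbs_bracket N r J (\<lambda>\<sigma>. A \<sigma> * (\<Prod>l\<in>{1..r}. 1 + t * edge_spin e (\<sigma> l)))
       = (\<Sum>S\<in>Pow {1..r}. t ^ card S * gibbs_bracket N r J (\<lambda>\<sigma>. A \<sigma> * (\<Prod>l\<in>S. edge_spin e (\<sigma> l))))"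
proof -
  have "(\<Prod>l\<in>{1..r}. 1 + t * edge_spin e (\<sigma> l))
      = (\<Sum>S\<in>Pow {1..r}. t ^ card S * (\<Prod>l\<in>S. edge_spin e (\<sigma> l)))" for \<sigma>
    using prod_add[of "{1..r}" "\<lambda>l. t * edge_spin e (\<sigma> l)" "\<lambda>_. 1"]
    by (simp add: prod.distrib add.commute)
  then show ?thesis
    unfolding gibbs_bracket_cmult[symmetric] gibbs_bracket_sum[symmetric]
    by (simp add: sum_distrib_left mult_ac)
qed

section \<open>Expansion in one coupling\<close>

text \<open>
  The Taylor polynomial of degree five of \<open>1 / (1 + u)\<close>.
\<close>

abbreviation geom6 :: "real poly" where
  "geom6 \<equiv> [:1, -1, 1, -1, 1, -1:]"

lemma poly_geom6: "(1 + u) * poly geom6 u = 1 - u ^ 6"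
  by (simp add: algebra_simps power_numeral_reduce)

lemma abs_poly_geom6_le: "\<bar>u\<bar> \<le> 1 \<Longrightarrow> \<bar>poly geom6 u\<bar> \<le> 6"
proof -
  assume u: "\<bar>u\<bar> \<le> 1"
  have e: "poly geom6 u = (\<Sum>k<6. (- u) ^ k)"
    by (simp add: algebra_simps power_numeral_reduce numeral_eq_Suc)
  have "\<bar>\<Sum>k<6. (- u) ^ k\<bar> \<le> (\<Sum>k<6. \<bar>(- u) ^ k\<bar>)" by (rule sum_abs)
  also have "\<dots> \<le> (\<Sum>k<(6::nat). 1)"
    using u by (intro sum_mono) (simp add: power_abs power_le_one)
  finally show ?thesis unfolding e by simp
qed

text \<open>
  As \<open>geom6\<close> is \<open>(1 - u^6) / (1 + u)\<close>, the error is \<open>(1 - (1 - u^6)^r) / (1 + u)^r\<close>, and Bernoulli's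
  inequality bounds the numerator by \<open>r u^6\<close>.  The power \<open>geom6 ^ r\<close> is not truncated again: its
  terms of degree above five are treated exactly like those of degree four.
\<close>

lemma inverse_power_approx:
  fixes u :: real
  assumes u: "\<bar>u\<bar> \<le> 1 / 2"
  shows "\<bar>1 / (1 + u) ^ r - poly (geom6 ^ r) u\<bar> \<le> 2 ^ r * real r * u ^ 6"
proof -
  have p: "1 / 2 \<le> 1 + u" using u by auto
  have "poly (geom6 ^ r) u * (1 + u) ^ r = (1 - u ^ 6) ^ r"
    unfolding poly_power power_mult_distrib[symmetric] by (simp only: poly_geom6 mult.commute)
  then have g: "poly (geom6 ^ r) u = (1 - u ^ 6) ^ r / (1 + u) ^ r"
    using p by (simp only: eq_divide_eq) simp
  have e: "1 / (1 + u) ^ r - poly (geom6 ^ r) u = (1 / (1 + u)) ^ r * (1 - (1 - u ^ 6) ^ r)"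
    unfolding g by (simp add: power_divide diff_divide_distrib)
  have u6: "0 \<le> u ^ 6" "u ^ 6 \<le> 1"
    using u power_le_one[of "\<bar>u\<bar>" 6] by (auto simp: power_even_abs)
  have "1 + real r * (- (u ^ 6)) \<le> (1 + (- (u ^ 6))) ^ r"
    using u6 by (intro Bernoulli_inequality) auto
  then have "1 - (1 - u ^ 6) ^ r \<le> real r * u ^ 6" by simp
  moreover have "0 \<le> 1 - (1 - u ^ 6) ^ r" using u6 power_le_one[of "1 - u ^ 6" r] by simp
  moreover have "(1 / (1 + u)) ^ r \<le> 2 ^ r" "0 \<le> (1 / (1 + u)) ^ r"
    using p by (auto intro!: power_mono simp: divide_le_eq)
  ultimately have "(1 / (1 + u)) ^ r * (1 - (1 - u ^ 6) ^ r) \<le> 2 ^ r * (real r * u ^ 6)"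
    and "0 \<le> (1 / (1 + u)) ^ r * (1 - (1 - u ^ 6) ^ r)"
    by (auto intro!: mult_mono)
  then show ?thesis unfolding e by (simp add: mult.assoc)
qed

lemma degree_geom6_power: "degree (geom6 ^ r) \<le> 5 * r"
  using degree_power_le[of geom6 r] by simp

lemma sk_gibbs_change_le:
  assumes e: "e \<in> site_pairs N" and N: "N \<ge> 1" and \<sigma>: "\<sigma> \<in> spin_configs N"
  shows "sk_gibbs N (J(e := x)) \<sigma> \<le> exp (2 * \<bar>x - y\<bar>) * sk_gibbs N (J(e := y)) \<sigma>"
proof -
  define d where "d = \<bar>x - y\<bar>"
  have dd: "\<bar>x - y\<bar> / sqrt (real N) \<le> d"
    using N mult_left_mono[of 1 "sqrt (real N)" "\<bar>x - y\<bar>"] unfolding d_def by (simp add: divide_le_eq)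
  have H: "\<bar>sk_hamiltonian N (J(e := x)) \<tau> - sk_hamiltonian N (J(e := y)) \<tau>\<bar> \<le> d"
    if "\<tau> \<in> spin_configs N" for \<tau>
  proof -
    have "sk_hamiltonian N (J(e := x)) \<tau> - sk_hamiltonian N (J(e := y)) \<tau>
        = (x - y) / sqrt (real N) * edge_spin e \<tau>"
      unfolding sk_hamiltonian_upd[OF e, of J x] sk_hamiltonian_upd[OF e, of J y]
      by (simp add: diff_divide_distrib left_diff_distrib)
    then show ?thesis using dd by (simp add: abs_mult abs_edge_spin[OF that e])
  qed
  let ?w = "\<lambda>x \<tau>. exp (sk_hamiltonian N (J(e := x)) \<tau>)"
  have num: "?w x \<sigma> \<le> exp d * ?w y \<sigma>" using H[OF \<sigma>] by (simp flip: exp_add)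
  have "?w y \<tau> \<le> exp d * ?w x \<tau>" if "\<tau> \<in> spin_configs N" for \<tau>
    using H[OF that] by (simp flip: exp_add)
  then have Z: "(\<Sum>\<tau>\<in>spin_configs N. ?w y \<tau>) \<le> exp d * (\<Sum>\<tau>\<in>spin_configs N. ?w x \<tau>)"
    unfolding sum_distrib_left by (rule sum_mono)
  have "?w x \<sigma> / (\<Sum>\<tau>\<in>spin_configs N. ?w x \<tau>)
     \<le> exp d * ?w y \<sigma> / ((\<Sum>\<tau>\<in>spin_configs N. ?w y \<tau>) / exp d)"
    using num Z by (intro frac_le) (auto simp: partition_function_pos divide_le_eq mult.commute)
  also have "\<dots> = exp (2 * d) * sk_gibbs N (J(e := y)) \<sigma>"
    unfolding sk_gibbs_def mult_2 exp_add by simp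
  finally show ?thesis unfolding sk_gibbs_def d_def .
qed

text \<open>
  A change of the coupling by \<open>d\<close> changes every Boltzmann weight by a factor of at most \<open>exp \<bar>d\<bar>\<close>; the
  weight and the partition function of each of the \<open>r\<close> replicas contribute one such factor.
\<close>

lemma gibbs_bracket_change_le:
  assumes "e \<in> site_pairs N" "N \<ge> 1" "\<And>\<sigma>. \<sigma> \<in> replica_configs N r \<Longrightarrow> 0 \<le> A \<sigma>"
  shows "gibbs_bracket N r (J(e := x)) A \<le> exp (2 * real r * \<bar>x - y\<bar>) * gibbs_bracket N r (J(e := y)) A"
proof -
  have "(\<Prod>l\<in>{1..r}. sk_gibbs N (J(e := x)) (\<sigma> l))
      \<le> exp (2 * real r * \<bar>x - y\<bar>) * (\<Prod>l\<in>{1..r}. sk_gibbs N (J(e := y)) (\<sigma> l))"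
    if "\<sigma> \<in> replica_configs N r" for \<sigma>
  proof -
    have "(\<Prod>l\<in>{1..r}. sk_gibbs N (J(e := x)) (\<sigma> l))
        \<le> (\<Prod>l\<in>{1..r}. exp (2 * \<bar>x - y\<bar>) * sk_gibbs N (J(e := y)) (\<sigma> l))"
      using assms replica_component[OF that]
      by (intro prod_mono conjI sk_gibbs_change_le[OF assms(1,2)] less_imp_le sk_gibbs_pos) auto
    also have "\<dots> = exp (2 * real r * \<bar>x - y\<bar>) * (\<Prod>l\<in>{1..r}. sk_gibbs N (J(e := y)) (\<sigma> l))"
      by (simp add: prod.distrib exp_of_nat_mult[symmetric] mult_ac)
    finally show ?thesis .
  qed
  then have "A \<sigma> * (\<Prod>l\<in>{1..r}. sk_gibbs N (J(e := x)) (\<sigma> l))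
     \<le> exp (2 * real r * \<bar>x - y\<bar>) * (A \<sigma> * (\<Prod>l\<in>{1..r}. sk_gibbs N (J(e := y)) (\<sigma> l)))"
    if "\<sigma> \<in> replica_configs N r" for \<sigma>
    using mult_left_mono[OF _ assms(3)[OF that]] that by (simp only: mult.left_commute)
  then show ?thesis unfolding gibbs_bracket_def sum_distrib_left by (rule sum_mono)
qed

text \<open>
  The terms of the expansion in \<open>t\<close>: the set \<open>S\<close> lists the replicas whose numerator \<open>1 + t s\<^sub>l\<close>
  contributes \<open>t s\<^sub>l\<close>, and \<open>j\<close> is the degree contributed by the normalisation \<open>(1 + t m)^-r\<close>.
\<close>

definition edge_correlation ::
  "nat \<Rightarrow> nat \<Rightarrow> nat \<times> nat \<Rightarrow> (nat \<times> nat \<Rightarrow> real) \<Rightarrow> ((nat \<Rightarrow> nat \<Rightarrow> real) \<Rightarrow> real) \<Rightarrow> nat set \<Rightarrow> nat \<Rightarrow> real"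
  where "edge_correlation N r e J A S j =
     gibbs_bracket N r J (\<lambda>\<sigma>. A \<sigma> * (\<Prod>l\<in>S. edge_spin e (\<sigma> l))) * gibbs_mean N J (edge_spin e) ^ j"

text \<open>
  The first summand covers \<open>\<bar>t\<bar> \<le> 1/2\<close>, with a factor \<open>2^r\<close> for the numerator and \<open>2^r r\<close> from
  \<open>inverse_power_approx\<close>.  The second covers \<open>\<bar>t\<bar> > 1/2\<close>, where \<open>1 \<le> 64 t^6\<close>; there \<open>12^r = 2^r 6^r\<close>
  bounds the numerator times the polynomial.
\<close>

definition remainder_const :: "nat \<Rightarrow> real" where
  "remainder_const r = 4 ^ r * real r + 64 * (1 + 12 ^ r)"

lemma remainder_const_nonneg: "0 \<le> remainder_const r"
  by (simp add: remainder_const_def)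

lemma abs_edge_prod:
  assumes "e \<in> site_pairs N" "\<sigma> \<in> replica_configs N r" "S \<subseteq> {1..r}"
  shows "\<bar>\<Prod>l\<in>S. edge_spin e (\<sigma> l)\<bar> = 1"
proof -
  have "\<bar>\<Prod>l\<in>S. edge_spin e (\<sigma> l)\<bar> = (\<Prod>l\<in>S. \<bar>edge_spin e (\<sigma> l)\<bar>)" by (rule abs_prod)
  also have "\<dots> = (\<Prod>l\<in>S. 1)"
    using assms replica_component[OF assms(2)] by (intro prod.cong refl abs_edge_spin[OF _ assms(1)]) auto
  finally show ?thesis by simp
qed

lemma edge_correlation_abs_le:
  assumes e: "e \<in> site_pairs N" and S: "S \<subseteq> {1..r}"
  shows "\<bar>edge_correlation N r e J A S j\<bar> \<le> gibbs_bracket N r J (\<lambda>\<sigma>. \<bar>A \<sigma>\<bar>)"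
proof -
  have 1: "\<bar>gibbs_bracket N r J (\<lambda>\<sigma>. A \<sigma> * (\<Prod>l\<in>S. edge_spin e (\<sigma> l)))\<bar> \<le> gibbs_bracket N r J (\<lambda>\<sigma>. \<bar>A \<sigma>\<bar>)"
    by (rule gibbs_bracket_abs_le) (simp add: abs_mult abs_edge_prod[OF e _ S])
  have 2: "\<bar>gibbs_mean N J (edge_spin e) ^ j\<bar> \<le> 1"
    using abs_gibbs_mean_edge_le[OF e] by (simp add: power_abs power_le_one)
  show ?thesis unfolding edge_correlation_def abs_mult
    using mult_mono[OF 1 2] by (simp add: gibbs_bracket_nonneg)
qed

text \<open>
  The remainder is of order \<open>t^6\<close> for every size of the coupling, at the price of the exponential
  factor: for \<open>t\<close> close to \<open>\<plusminus>1\<close> the denominator \<open>1 + t m\<close> can be as small as \<open>1 - \<bar>t\<bar>\<close>, and both the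
  bracket and the polynomial are then bounded separately.  Having \<open>\<langle>|A|\<rangle>\<^sub>0\<close> on the right instead of the
  supremum of \<open>A\<close> is what makes the expansion usable for multiplicative estimates.
\<close>

lemma edge_expansion:
  fixes x :: real
  assumes e: "e \<in> site_pairs N" and N: "N \<ge> 1"
  defines "t \<equiv> tanh (x / sqrt (real N))"
  shows "\<bar>gibbs_bracket N r (J(e := x)) A
      - (\<Sum>S\<in>Pow {1..r}. \<Sum>j\<le>5 * r. coeff (geom6 ^ r) j * t ^ (card S + j) * edge_correlation N r e (J(e := 0)) A S j)\<bar>
    \<le> remainder_const r * exp (2 * real r * \<bar>x\<bar>) * t ^ 6 * gibbs_bracket N r (J(e := 0)) (\<lambda>\<sigma>. \<bar>A \<sigma>\<bar>)"
proof -
  let ?J0 = "J(e := 0)"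
  define m where "m = gibbs_mean N ?J0 (edge_spin e)"
  define n where "n = gibbs_bracket N r ?J0 (\<lambda>\<sigma>. A \<sigma> * (\<Prod>l\<in>{1..r}. 1 + t * edge_spin e (\<sigma> l)))"
  define a where "a = gibbs_bracket N r ?J0 (\<lambda>\<sigma>. \<bar>A \<sigma>\<bar>)"
  define E where "E = exp (2 * real r * \<bar>x\<bar>)"
  have m: "\<bar>m\<bar> \<le> 1" unfolding m_def by (rule abs_gibbs_mean_edge_le[OF e])
  have t: "\<bar>t\<bar> < 1" unfolding t_def using tanh_real_bounds[of "x / sqrt (real N)"] by (auto simp: abs_less_iff)
  have u: "\<bar>t * m\<bar> \<le> \<bar>t\<bar>" using m by (simp add: abs_mult mult_left_le)
  have a: "0 \<le> a" unfolding a_def by (rule gibbs_bracket_nonneg) simp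
  have E: "1 \<le> E" unfolding E_def by simp
  have n: "\<bar>n\<bar> \<le> 2 ^ r * a"
    unfolding n_def a_def gibbs_bracket_cmult[symmetric]
  proof (rule gibbs_bracket_abs_le)
    fix \<sigma> assume \<sigma>: "\<sigma> \<in> replica_configs N r"
    have "\<bar>\<Prod>l\<in>{1..r}. 1 + t * edge_spin e (\<sigma> l)\<bar> = (\<Prod>l\<in>{1..r}. \<bar>1 + t * edge_spin e (\<sigma> l)\<bar>)"
      by (rule abs_prod)
    also have "\<dots> \<le> (\<Prod>l\<in>{1..r}. 2)"
      using t edge_spin_values[OF replica_component[OF \<sigma>] e] by (intro prod_mono conjI) fastforce+
    finally show "\<bar>A \<sigma> * (\<Prod>l\<in>{1..r}. 1 + t * edge_spin e (\<sigma> l))\<bar> \<le> 2 ^ r * \<bar>A \<sigma>\<bar>"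
      unfolding abs_mult mult.commute[of "2 ^ r"] by (intro mult_left_mono) auto
  qed
  have f: "gibbs_bracket N r (J(e := x)) A = n * (1 / (1 + t * m) ^ r)"
    unfolding n_def m_def t_def gibbs_bracket_tilt[OF e, of r J x A] by simp
  have P: "poly (geom6 ^ r) z = (\<Sum>j\<le>5 * r. coeff (geom6 ^ r) j * z ^ j)" for z
    unfolding poly_altdef
    by (intro sum.mono_neutral_left) (use degree_geom6_power[of r] in \<open>auto simp: coeff_eq_0\<close>)
  have main: "(\<Sum>S\<in>Pow {1..r}. \<Sum>j\<le>5 * r. coeff (geom6 ^ r) j * t ^ (card S + j) * edge_correlation N r e ?J0 A S j)
     = n * poly (geom6 ^ r) (t * m)"
    unfolding n_def gibbs_bracket_tilt_expand[OF e] P sum_product edge_correlation_def m_def[symmetric]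
    by (intro sum.cong refl) (simp add: power_add power_mult_distrib mult_ac)
  have "\<bar>n * (1 / (1 + t * m) ^ r) - n * poly (geom6 ^ r) (t * m)\<bar> \<le> remainder_const r * E * t ^ 6 * a"
  proof (cases "\<bar>t\<bar> \<le> 1 / 2")
    case True
    have "(t * m) ^ 6 \<le> t ^ 6" using power_mono[OF u, of 6] by (simp add: power_even_abs)
    then have "\<bar>1 / (1 + t * m) ^ r - poly (geom6 ^ r) (t * m)\<bar> \<le> 2 ^ r * real r * t ^ 6"
      using u True by (intro order_trans[OF inverse_power_approx]) (auto intro: mult_left_mono)
    then have "\<bar>n\<bar> * \<bar>1 / (1 + t * m) ^ r - poly (geom6 ^ r) (t * m)\<bar> \<le> (2 ^ r * a) * (2 ^ r * real r * t ^ 6)"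
      using n by (intro mult_mono) auto
    also have "\<dots> = (4 ^ r * real r * 1) * t ^ 6 * a" by (simp add: power_mult_distrib[symmetric])
    also have "\<dots> \<le> (remainder_const r * E) * t ^ 6 * a"
      using a E by (intro mult_right_mono mult_mono) (auto simp: remainder_const_def)
    finally show ?thesis unfolding right_diff_distrib[symmetric] abs_mult[of n] .
  next
    case False
    have t6: "1 \<le> 64 * t ^ 6"
      using False power_mono[of "1/2" "\<bar>t\<bar>" 6] by (simp add: power_even_abs power_one_over)
    have "\<bar>gibbs_bracket N r (J(e := x)) A\<bar> \<le> gibbs_bracket N r (J(e := x)) (\<lambda>\<sigma>. \<bar>A \<sigma>\<bar>)"
      by (rule gibbs_bracket_abs_le) simp
    also have "\<dots> \<le> E * a" unfolding E_def a_def
      using gibbs_bracket_change_le[OF e N, of r "\<lambda>\<sigma>. \<bar>A \<sigma>\<bar>" J x 0] by simp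
    finally have 1: "\<bar>n * (1 / (1 + t * m) ^ r)\<bar> \<le> E * a" unfolding f .
    have "\<bar>poly (geom6 ^ r) (t * m)\<bar> \<le> 6 ^ r"
      unfolding poly_power power_abs using u t by (intro power_mono abs_poly_geom6_le) auto
    then have "\<bar>n * poly (geom6 ^ r) (t * m)\<bar> \<le> (2 ^ r * a) * 6 ^ r"
      unfolding abs_mult using n by (intro mult_mono) auto
    also have "\<dots> = 12 ^ r * (1 * a)" by (simp add: power_mult_distrib[symmetric])
    also have "\<dots> \<le> 12 ^ r * (E * a)" using a E by (intro mult_left_mono mult_right_mono) auto
    finally have "\<bar>n * (1 / (1 + t * m) ^ r) - n * poly (geom6 ^ r) (t * m)\<bar> \<le> (1 + 12 ^ r) * (E * a) * 1"
      using 1 unfolding mult_1_right distrib_right mult_1 by linarith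
    also have "\<dots> \<le> (1 + 12 ^ r) * (E * a) * (64 * t ^ 6)"
      using a E t6 by (intro mult_left_mono) auto
    also have "\<dots> = (64 * (1 + 12 ^ r)) * (E * t ^ 6 * a)" by simp
    also have "\<dots> \<le> remainder_const r * (E * t ^ 6 * a)"
      using a E by (intro mult_right_mono) (auto simp: remainder_const_def)
    finally show ?thesis by (simp add: mult_ac)
  qed
  then show ?thesis unfolding main f a_def E_def .
qed

section \<open>Laws of the couplings\<close>

text \<open>
  The class of laws on which the comparison runs.  It contains the bounded laws of the theorem and
  the Gaussian law and, for fixed \<open>a\<close> and \<open>K\<close>, is closed under mixtures.  Extended integrals are used
  because a bound on them includes integrability.
\<close>

definition good_law :: "real \<Rightarrow> real \<Rightarrow> real measure \<Rightarrow> bool" where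
  "good_law a K \<mu> \<longleftrightarrow> prob_space \<mu> \<and> sets \<mu> = sets borel \<and> distr \<mu> borel uminus = \<mu> \<and>
     (\<integral>\<^sup>+ x. ennreal (x\<^sup>2) \<partial>\<mu>) = 1 \<and> (\<integral>\<^sup>+ x. ennreal (exp (a * \<bar>x\<bar>)) \<partial>\<mu>) \<le> ennreal K"

definition tanh_moment :: "nat \<Rightarrow> real measure \<Rightarrow> nat \<Rightarrow> real" where
  "tanh_moment N \<mu> k = (LINT x|\<mu>. tanh (x / sqrt (real N)) ^ k)"

lemma abs_tanh_le: "\<bar>tanh h\<bar> \<le> \<bar>h\<bar>" for h :: real
proof -
  have *: "tanh y \<le> y" if "0 \<le> y" for y :: real
  proof -
    have "0 - tanh 0 \<le> y - tanh (y :: real)"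
      by (rule DERIV_nonneg_imp_nondecreasing[OF that])
         (auto intro!: exI derivative_eq_intros)
    then show ?thesis by simp
  qed
  show ?thesis using *[of "\<bar>h\<bar>"] by simp
qed

lemma tanh_power_le:
  fixes h :: real
  assumes "m \<le> k"
  shows "\<bar>tanh h\<bar> ^ k \<le> \<bar>h\<bar> ^ m"
proof -
  have "\<bar>tanh h\<bar> ^ k \<le> \<bar>tanh h\<bar> ^ m"
    using assms tanh_real_bounds[of h] by (intro power_decreasing) (auto simp: abs_le_iff)
  also have "\<dots> \<le> \<bar>h\<bar> ^ m" by (intro power_mono abs_tanh_le) auto
  finally show ?thesis .
qed

lemma abs_tanh_power_le_1: "\<bar>tanh (x / sqrt (real N)) ^ k\<bar> \<le> 1" for x :: real
  using tanh_real_bounds[of "x / sqrt (real N)"] by (auto simp: power_abs abs_le_iff intro!: power_le_one)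

text \<open>
  From \<open>\<bar>h\<bar> \<le> \<bar>sinh h\<bar>\<close> and \<open>tanh\<^sup>2 = 1 - 1 / (1 + sinh\<^sup>2)\<close>, so that \<open>tanh\<^sup>2 h \<ge> h\<^sup>2 / (1 + h\<^sup>2)\<close>.
\<close>

lemma tanh_square_ge: "h\<^sup>2 - h ^ 4 \<le> (tanh h)\<^sup>2" for h :: real
proof -
  have "\<bar>h\<bar> \<le> \<bar>sinh h\<bar>"
    using real_le_abs_sinh[of h] by (simp add: sinh_field_def exp_minus)
  then have s: "h\<^sup>2 \<le> (sinh h)\<^sup>2" by (rule abs_le_square_iff[THEN iffD1])
  have "1 - (tanh h)\<^sup>2 = ((cosh h)\<^sup>2 - (sinh h)\<^sup>2) / (cosh h)\<^sup>2"
    by (simp add: tanh_def power_divide diff_divide_distrib)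
  also have "\<dots> = 1 / (cosh h)\<^sup>2" unfolding hyperbolic_pythagoras ..
  also have "\<dots> \<le> 1 / (1 + h\<^sup>2)"
    using s by (intro frac_le) (simp_all add: cosh_square_eq add_pos_nonneg)
  finally have "1 - 1 / (1 + h\<^sup>2) \<le> (tanh h)\<^sup>2" by simp
  moreover have "h\<^sup>2 - h ^ 4 \<le> 1 - 1 / (1 + h\<^sup>2)"
  proof -
    have "(h\<^sup>2 - h ^ 4) * (1 + h\<^sup>2) = h\<^sup>2 - h ^ 6"
      by (simp add: algebra_simps power_numeral_reduce)
    also have "\<dots> \<le> h\<^sup>2" by simp
    finally have "(h\<^sup>2 - h ^ 4) * (1 + h\<^sup>2) \<le> h\<^sup>2" .
    then have "h\<^sup>2 - h ^ 4 \<le> h\<^sup>2 / (1 + h\<^sup>2)"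
      by (simp add: pos_le_divide_eq add_pos_nonneg)
    moreover have "1 - 1 / D = (D - 1) / D" if "0 < D" for D :: real
      using that by (simp add: diff_divide_distrib)
    from this[of "1 + h\<^sup>2"] have "1 - 1 / (1 + h\<^sup>2) = h\<^sup>2 / (1 + h\<^sup>2)"
      by (simp add: add_pos_nonneg)
    ultimately show ?thesis by simp
  qed
  ultimately show ?thesis by linarith
qed

lemma divide_sqrt_power_even:
  "\<bar>x / sqrt (real N)\<bar> ^ (2 * n) = \<bar>x\<bar> ^ (2 * n) / real N ^ n"
  by (simp add: power_divide power_mult)

lemma power_le_fact_exp: "y ^ n \<le> fact n * exp y" if "0 \<le> y" for y :: real
proof -
  have "(\<Sum>k\<in>{n}. y ^ k /\<^sub>R fact k) \<le> (\<Sum>k. y ^ k /\<^sub>R fact k)"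
    using that by (intro sum_le_suminf summable_exp_generic) auto
  then show ?thesis unfolding exp_def by (simp add: divide_inverse[symmetric] field_simps)
qed

context
  fixes a K :: real and \<mu> :: "real measure"
  assumes good: "good_law a K \<mu>"
begin

lemma good_law_prob: "prob_space \<mu>" and good_law_sets [measurable_cong]: "sets \<mu> = sets borel"
  using good by (auto simp: good_law_def)

lemma good_law_space: "space \<mu> = UNIV"
  using sets_eq_imp_space_eq[OF good_law_sets] by simp

lemma good_law_integrable_bounded:
  fixes f :: "real \<Rightarrow> real"
  assumes "f \<in> borel_measurable borel" "\<And>x. \<bar>f x\<bar> \<le> B"
  shows "integrable \<mu> f"
proof -
  interpret prob_space \<mu> by (rule good_law_prob)
  show ?thesis using assms by (intro integrable_const_bound[of _ B]) auto
qed

lemma good_law_exp_integrable: "integrable \<mu> (\<lambda>x. exp (a * \<bar>x\<bar>))"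
  and good_law_exp_le: "0 \<le> K \<Longrightarrow> (LINT x|\<mu>. exp (a * \<bar>x\<bar>)) \<le> K"
proof -
  have le: "(\<integral>\<^sup>+ x. ennreal (exp (a * \<bar>x\<bar>)) \<partial>\<mu>) \<le> ennreal K"
    using good by (simp add: good_law_def)
  then show 1: "integrable \<mu> (\<lambda>x. exp (a * \<bar>x\<bar>))"
    by (intro integrableI_bounded) (auto simp: less_top[symmetric] top_unique)
  show "(LINT x|\<mu>. exp (a * \<bar>x\<bar>)) \<le> K" if "0 \<le> K"
    using le that unfolding nn_integral_eq_integral[OF 1, simplified] by simp
qed

lemma good_law_K_ge_1: "0 \<le> a \<Longrightarrow> 1 \<le> K"
proof -
  assume a: "0 \<le> a"
  interpret prob_space \<mu> by (rule good_law_prob)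
  have "ennreal 1 = (\<integral>\<^sup>+ x. 1 \<partial>\<mu>)" by (simp add: emeasure_space_1)
  also have "\<dots> \<le> (\<integral>\<^sup>+ x. ennreal (exp (a * \<bar>x\<bar>)) \<partial>\<mu>)"
    using a by (intro nn_integral_mono) (simp flip: ennreal_1)
  also have "\<dots> \<le> ennreal K" using good by (simp add: good_law_def)
  finally show ?thesis by (simp add: ennreal_le_iff2)
qed

lemma good_law_dominated:
  fixes f :: "real \<Rightarrow> real"
  assumes a: "0 \<le> a" and f: "f \<in> borel_measurable borel" "\<And>x. \<bar>f x\<bar> \<le> c * exp (a * \<bar>x\<bar>)" and c: "0 \<le> c"
  shows "integrable \<mu> f" "\<bar>LINT x|\<mu>. f x\<bar> \<le> c * K"
proof -
  have i: "integrable \<mu> (\<lambda>x. c * exp (a * \<bar>x\<bar>))" using good_law_exp_integrable by simp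
  show f': "integrable \<mu> f"
    by (rule Bochner_Integration.integrable_bound[OF i]) (use f c in auto)
  have "\<bar>LINT x|\<mu>. f x\<bar> \<le> (LINT x|\<mu>. \<bar>f x\<bar>)" by (rule integral_abs_bound)
  also have "\<dots> \<le> (LINT x|\<mu>. c * exp (a * \<bar>x\<bar>))" using f' i f by (intro integral_mono) auto
  also have "\<dots> \<le> c * K"
    using good_law_exp_le good_law_K_ge_1[OF a] c by (simp add: mult_left_mono)
  finally show "\<bar>LINT x|\<mu>. f x\<bar> \<le> c * K" .
qed

lemma good_law_square: "integrable \<mu> (\<lambda>x. x\<^sup>2)" "(LINT x|\<mu>. x\<^sup>2) = 1"
proof -
  have 1: "(\<integral>\<^sup>+ x. ennreal (x\<^sup>2) \<partial>\<mu>) = 1" using good by (simp add: good_law_def)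
  then show "integrable \<mu> (\<lambda>x. x\<^sup>2)" by (intro integrableI_bounded) auto
  from nn_integral_eq_integral[OF this] 1 show "(LINT x|\<mu>. x\<^sup>2) = 1" by simp
qed

lemma good_law_power:
  assumes "1 \<le> a"
  shows "integrable \<mu> (\<lambda>x. \<bar>x\<bar> ^ n)" "(LINT x|\<mu>. \<bar>x\<bar> ^ n) \<le> fact n * K"
proof -
  have b: "\<bar>x\<bar> ^ n \<le> fact n * exp (a * \<bar>x\<bar>)" for x :: real
  proof -
    have "\<bar>x\<bar> ^ n \<le> fact n * exp \<bar>x\<bar>" by (rule power_le_fact_exp) simp
    also have "\<dots> \<le> fact n * exp (a * \<bar>x\<bar>)"
      using assms mult_right_mono[of 1 a "\<bar>x\<bar>"] by (intro mult_left_mono) auto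
    finally show ?thesis .
  qed
  show "integrable \<mu> (\<lambda>x. \<bar>x\<bar> ^ n)"
    by (rule good_law_dominated(1)[of _ "fact n"]) (use assms b in auto)
  have "\<bar>LINT x|\<mu>. \<bar>x\<bar> ^ n\<bar> \<le> fact n * K"
    by (rule good_law_dominated(2)[of _ "fact n"]) (use assms b in auto)
  then show "(LINT x|\<mu>. \<bar>x\<bar> ^ n) \<le> fact n * K" by linarith
qed

lemma tanh_power_integrable: "integrable \<mu> (\<lambda>x. tanh (x / sqrt (real N)) ^ k)"
proof -
  have "continuous_on UNIV (\<lambda>x::real. tanh (x / sqrt (real N)) ^ k)"
    unfolding divide_inverse by (intro continuous_intros) auto
  then have "(\<lambda>x::real. tanh (x / sqrt (real N)) ^ k) \<in> borel_measurable borel"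
    by (rule borel_measurable_continuous_onI)
  then show ?thesis by (rule good_law_integrable_bounded) (rule abs_tanh_power_le_1)
qed

lemma tanh_moment_odd:
  assumes "odd k"
  shows "tanh_moment N \<mu> k = 0"
proof -
  let ?g = "\<lambda>x::real. tanh (x / sqrt (real N)) ^ k"
  have sym: "distr \<mu> borel uminus = \<mu>" using good by (simp add: good_law_def)
  have "tanh_moment N \<mu> k = integral\<^sup>L (distr \<mu> borel uminus) ?g"
    unfolding sym tanh_moment_def ..
  also have "\<dots> = (LINT x|\<mu>. ?g (- x))"
    using borel_measurable_integrable[OF tanh_power_integrable]
    by (intro integral_distr) auto
  also have "\<dots> = - tanh_moment N \<mu> k"
    unfolding tanh_moment_def using assms by simp
  finally show ?thesis by simp
qed

lemma tanh_moment_0: "tanh_moment N \<mu> 0 = 1"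
proof -
  interpret prob_space \<mu> by (rule good_law_prob)
  show ?thesis by (simp add: tanh_moment_def prob_space)
qed

lemma tanh_moment_le:
  assumes "k \<noteq> 0"
  shows "\<bar>tanh_moment N \<mu> k\<bar> \<le> 1 / real N"
proof (cases "odd k")
  case True then show ?thesis by (simp add: tanh_moment_odd)
next
  case False
  then have k: "2 \<le> k" using assms by (cases "k = 1") auto
  have "\<bar>tanh_moment N \<mu> k\<bar> \<le> (LINT x|\<mu>. \<bar>tanh (x / sqrt (real N)) ^ k\<bar>)"
    unfolding tanh_moment_def by (rule integral_abs_bound)
  also have "\<dots> \<le> (LINT x|\<mu>. x\<^sup>2 / real N)"
  proof (intro integral_mono)
    show "\<bar>tanh (x / sqrt (real N)) ^ k\<bar> \<le> x\<^sup>2 / real N" for x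
      using tanh_power_le[OF k, of "x / sqrt (real N)"] by (simp add: power_abs power_divide)
  qed (auto intro!: integrable_abs tanh_power_integrable good_law_square)
  also have "\<dots> = 1 / real N" using good_law_square by simp
  finally show ?thesis .
qed

lemma tanh_moment_2:
  assumes "1 \<le> a"
  shows "\<bar>tanh_moment N \<mu> 2 - 1 / real N\<bar> \<le> 24 * K / (real N)\<^sup>2"
proof -
  let ?t = "\<lambda>x. tanh (x / sqrt (real N))"
  have i4: "integrable \<mu> (\<lambda>x. \<bar>x\<bar> ^ 4 / (real N)\<^sup>2)"
    by (intro integrable_divide good_law_power assms)
  have "\<bar>LINT x|\<mu>. (?t x)\<^sup>2 - x\<^sup>2 / real N\<bar> \<le> (LINT x|\<mu>. \<bar>(?t x)\<^sup>2 - x\<^sup>2 / real N\<bar>)"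
    by (rule integral_abs_bound)
  also have "\<dots> \<le> (LINT x|\<mu>. \<bar>x\<bar> ^ 4 / (real N)\<^sup>2)"
  proof (intro integral_mono)
    fix x :: real
    have "(x / sqrt (real N))\<^sup>2 = x\<^sup>2 / real N" "(x / sqrt (real N)) ^ 4 = \<bar>x\<bar> ^ 4 / (real N)\<^sup>2"
      using divide_sqrt_power_even[of x N 2] by (auto simp: power_divide)
    moreover have "(?t x)\<^sup>2 \<le> (x / sqrt (real N))\<^sup>2"
      using abs_tanh_le by (rule abs_le_square_iff[THEN iffD1])
    ultimately show "\<bar>(?t x)\<^sup>2 - x\<^sup>2 / real N\<bar> \<le> \<bar>x\<bar> ^ 4 / (real N)\<^sup>2"
      using tanh_square_ge[of "x / sqrt (real N)"] by simp
  qed (use i4 in \<open>auto intro!: tanh_power_integrable good_law_square Bochner_Integration.integrable_diff\<close>)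
  also have "\<dots> = (LINT x|\<mu>. \<bar>x\<bar> ^ 4) / (real N)\<^sup>2" by simp
  also have "\<dots> \<le> 24 * K / (real N)\<^sup>2"
    using good_law_power(2)[OF assms, of 4] by (intro divide_right_mono) (auto simp: fact_numeral)
  also have "(LINT x|\<mu>. (?t x)\<^sup>2 - x\<^sup>2 / real N) = tanh_moment N \<mu> 2 - 1 / real N"
    using tanh_power_integrable good_law_square by (subst Bochner_Integration.integral_diff) (auto simp: tanh_moment_def)
  finally show ?thesis .
qed

lemma tanh_moment_ge_4:
  assumes "1 \<le> a" "4 \<le> k"
  shows "\<bar>tanh_moment N \<mu> k\<bar> \<le> 24 * K / (real N)\<^sup>2"
proof -
  have i4: "integrable \<mu> (\<lambda>x. \<bar>x\<bar> ^ 4 / (real N)\<^sup>2)"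
    by (intro integrable_divide good_law_power assms)
  have "\<bar>tanh_moment N \<mu> k\<bar> \<le> (LINT x|\<mu>. \<bar>tanh (x / sqrt (real N)) ^ k\<bar>)"
    unfolding tanh_moment_def by (rule integral_abs_bound)
  also have "\<dots> \<le> (LINT x|\<mu>. \<bar>x\<bar> ^ 4 / (real N)\<^sup>2)"
  proof (intro integral_mono)
    show "\<bar>tanh (x / sqrt (real N)) ^ k\<bar> \<le> \<bar>x\<bar> ^ 4 / (real N)\<^sup>2" for x
      using tanh_power_le[OF assms(2), of "x / sqrt (real N)"] divide_sqrt_power_even[of x N 2]
      by (simp add: power_abs)
  qed (use i4 in \<open>auto intro!: integrable_abs tanh_power_integrable\<close>)
  also have "\<dots> = (LINT x|\<mu>. \<bar>x\<bar> ^ 4) / (real N)\<^sup>2" by simp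
  also have "\<dots> \<le> 24 * K / (real N)\<^sup>2"
    using good_law_power(2)[OF assms(1), of 4] by (intro divide_right_mono) (auto simp: fact_numeral)
  finally show ?thesis .
qed

end

text \<open>
  The variances agree, so the leading part \<open>1 / N\<close> of the second moment cancels, and what remains is
  controlled by the fourth moment of the law, at scale \<open>N^-2\<close>; odd moments vanish by symmetry.
\<close>

lemma tanh_moment_diff_le:
  assumes g: "good_law a K \<mu>" "good_law a K \<mu>'" and a: "1 \<le> a"
  shows "\<bar>tanh_moment N \<mu> k - tanh_moment N \<mu>' k\<bar> \<le> 48 * K / (real N)\<^sup>2"
proof -
  have K: "0 \<le> K" using good_law_K_ge_1[OF g(1)] a by simp
  have "k = 0 \<or> odd k \<or> k = 2 \<or> 4 \<le> k" by presburger
  then consider "k = 0" | "odd k" | "k = 2" | "4 \<le> k" by blast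
  then show ?thesis
  proof cases
    case 1 then show ?thesis using K by (simp add: tanh_moment_0[OF g(1)] tanh_moment_0[OF g(2)])
  next
    case 2 then show ?thesis using K by (simp add: tanh_moment_odd[OF g(1)] tanh_moment_odd[OF g(2)])
  next
    case 3
    show ?thesis
      using tanh_moment_2[OF g(1) a, of N] tanh_moment_2[OF g(2) a, of N] unfolding 3 by simp
  next
    case 4
    show ?thesis
      using tanh_moment_ge_4[OF g(1) a 4, of N] tanh_moment_ge_4[OF g(2) a 4, of N] by simp
  qed
qed

section \<open>Averaging over one coupling\<close>

lemma gibbs_bracket_measurable:
  assumes [measurable]: "\<And>p. p \<in> site_pairs N \<Longrightarrow> (\<lambda>\<omega>. g \<omega> p) \<in> borel_measurable M"
  shows "(\<lambda>\<omega>. gibbs_bracket N r (g \<omega>) A) \<in> borel_measurable M"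
proof -
  have [measurable]: "(\<lambda>\<omega>. sk_hamiltonian N (g \<omega>) \<sigma>) \<in> borel_measurable M" for \<sigma>
    unfolding sk_hamiltonian_def case_prod_unfold prod.collapse by measurable
  have [measurable]: "(\<lambda>\<omega>. sk_gibbs N (g \<omega>) \<sigma>) \<in> borel_measurable M" for \<sigma>
    unfolding sk_gibbs_def by measurable
  show ?thesis unfolding gibbs_bracket_def by measurable
qed

lemma gibbs_bracket_upd_measurable:
  "(\<lambda>x. gibbs_bracket N r (J(e := x)) A) \<in> borel_measurable borel"
  by (intro gibbs_bracket_measurable) (auto simp: fun_upd_def)

lemma gibbs_bracket_abs_le_sup_norm: "\<bar>gibbs_bracket N r J A\<bar> \<le> sup_norm N r A"
  by (rule gibbs_bracket_abs_le_const) (rule abs_le_sup_norm)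

definition edge_average ::
  "real measure \<Rightarrow> nat \<Rightarrow> nat \<Rightarrow> nat \<times> nat \<Rightarrow> ((nat \<Rightarrow> nat \<Rightarrow> real) \<Rightarrow> real) \<Rightarrow> (nat \<times> nat \<Rightarrow> real) \<Rightarrow> real"
  where "edge_average \<mu> N r e A J = (LINT x|\<mu>. gibbs_bracket N r (J(e := x)) A)"

lemma gibbs_bracket_upd_integrable:
  "good_law a K \<mu> \<Longrightarrow> integrable \<mu> (\<lambda>x. gibbs_bracket N r (J(e := x)) A)"
  by (rule good_law_integrable_bounded[OF _ gibbs_bracket_upd_measurable gibbs_bracket_abs_le_sup_norm])

text \<open>
  The expansion is integrated term by term.  Since \<open>\<bar>t\<bar>^6 \<le> x^6 / N^3\<close> and \<open>x^6 \<le> 720 exp \<bar>x\<bar>\<close>, an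
  exponential moment of order \<open>2 r + 1\<close> dominates the remainder.
\<close>

lemma edge_average_expansion:
  assumes g: "good_law a K \<mu>" and a: "2 * real r + 1 \<le> a" and e: "e \<in> site_pairs N" and N: "N \<ge> 1"
  shows "\<bar>edge_average \<mu> N r e A J
      - (\<Sum>S\<in>Pow {1..r}. \<Sum>j\<le>5 * r. coeff (geom6 ^ r) j * tanh_moment N \<mu> (card S + j)
            * edge_correlation N r e (J(e := 0)) A S j)\<bar>
    \<le> 720 * remainder_const r * K / real N ^ 3 * gibbs_bracket N r (J(e := 0)) (\<lambda>\<sigma>. \<bar>A \<sigma>\<bar>)"
proof -
  let ?t = "\<lambda>x. tanh (x / sqrt (real N))" and ?c = "coeff (geom6 ^ r)"
  let ?E = "edge_correlation N r e (J(e := 0)) A"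
  let ?f = "\<lambda>x. gibbs_bracket N r (J(e := x)) A"
  let ?P = "\<lambda>x. \<Sum>S\<in>Pow {1..r}. \<Sum>j\<le>5 * r. ?c j * ?t x ^ (card S + j) * ?E S j"
  define a0 where "a0 = gibbs_bracket N r (J(e := 0)) (\<lambda>\<sigma>. \<bar>A \<sigma>\<bar>)"
  define c where "c = 720 * remainder_const r / real N ^ 3 * a0"
  have a0: "0 \<le> a0" unfolding a0_def by (rule gibbs_bracket_nonneg) simp
  have c: "0 \<le> c" using a0 by (simp add: c_def remainder_const_nonneg)
  have f: "integrable \<mu> ?f" by (rule gibbs_bracket_upd_integrable[OF g])
  have P: "integrable \<mu> ?P"
    by (intro Bochner_Integration.integrable_sum integrable_mult_left integrable_mult_right tanh_power_integrable[OF g])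
  have int: "(LINT x|\<mu>. ?f x - ?P x) = edge_average \<mu> N r e A J
      - (\<Sum>S\<in>Pow {1..r}. \<Sum>j\<le>5 * r. ?c j * tanh_moment N \<mu> (card S + j) * ?E S j)"
    unfolding Bochner_Integration.integral_diff[OF f P] edge_average_def tanh_moment_def
    by (simp add: Bochner_Integration.integral_sum tanh_power_integrable[OF g])
  have bound: "\<bar>?f x - ?P x\<bar> \<le> c * exp (a * \<bar>x\<bar>)" for x
  proof -
    have "?t x ^ 6 \<le> \<bar>x\<bar> ^ 6 / real N ^ 3"
      using tanh_power_le[of 6 6 "x / sqrt (real N)"] divide_sqrt_power_even[of x N 3]
      by (simp add: power_even_abs)
    also have "\<dots> \<le> 720 * exp \<bar>x\<bar> / real N ^ 3"
      using power_le_fact_exp[of "\<bar>x\<bar>" 6] by (intro divide_right_mono) (auto simp: fact_numeral)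
    finally have t: "?t x ^ 6 \<le> 720 * exp \<bar>x\<bar> / real N ^ 3" .
    have "\<bar>?f x - ?P x\<bar> \<le> (remainder_const r * a0) * (exp (2 * real r * \<bar>x\<bar>) * ?t x ^ 6)"
      using edge_expansion[OF e N, of r J x A] unfolding a0_def by (simp only: mult_ac)
    also have "\<dots> \<le> (remainder_const r * a0) * (exp (2 * real r * \<bar>x\<bar>) * (720 * exp \<bar>x\<bar> / real N ^ 3))"
      using t a0 remainder_const_nonneg by (intro mult_left_mono) auto
    also have "\<dots> = c * exp ((2 * real r + 1) * \<bar>x\<bar>)"
      unfolding c_def distrib_right exp_add by simp
    also have "\<dots> \<le> c * exp (a * \<bar>x\<bar>)"
      using a c by (intro mult_left_mono) (auto intro: mult_right_mono)
    finally show ?thesis .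
  qed
  have "\<bar>LINT x|\<mu>. ?f x - ?P x\<bar> \<le> c * K"
  proof (rule good_law_dominated(2)[OF g _ _ bound c])
    show "0 \<le> a" using a by simp
    show "(\<lambda>x. ?f x - ?P x) \<in> borel_measurable borel"
      using borel_measurable_integrable[OF Bochner_Integration.integrable_diff[OF f P]]
      by (simp add: good_law_sets[OF g] cong: measurable_cong_sets)
  qed
  then show ?thesis unfolding int c_def a0_def by (simp add: mult_ac)
qed

text \<open>
  The average of \<open>\<langle>A\<rangle>\<^sub>x\<close> is at least \<open>\<langle>A\<rangle>\<^sub>0\<close> times the mean of \<open>exp (- a \<bar>x\<bar>)\<close>, and the latter is at least
  \<open>1 / K\<close> when the mean of \<open>exp (a \<bar>x\<bar>)\<close> is at most \<open>K\<close>.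
\<close>

lemma cavity_le_edge_average:
  assumes g: "good_law a K \<mu>" and a: "2 * real r \<le> a" and e: "e \<in> site_pairs N" and N: "N \<ge> 1"
    and A: "\<And>\<sigma>. \<sigma> \<in> replica_configs N r \<Longrightarrow> 0 \<le> A \<sigma>"
  shows "gibbs_bracket N r (J(e := 0)) A \<le> K * edge_average \<mu> N r e A J"
proof -
  interpret prob_space \<mu> by (rule good_law_prob[OF g])
  let ?f = "\<lambda>x. gibbs_bracket N r (J(e := x)) A"
  define f0 where "f0 = ?f 0"
  have a0: "0 \<le> a" using a by simp
  have K: "1 \<le> K" by (rule good_law_K_ge_1[OF g a0])
  have f0: "0 \<le> f0" unfolding f0_def by (rule gibbs_bracket_nonneg[OF A])
  have int: "integrable \<mu> (\<lambda>x. exp (a * \<bar>x\<bar>))" by (rule good_law_exp_integrable[OF g])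
  have le: "f0 * (2 / K - exp (a * \<bar>x\<bar>) / K\<^sup>2) \<le> ?f x" for x
  proof -
    have "f0 \<le> exp (2 * real r * \<bar>x\<bar>) * ?f x"
      using gibbs_bracket_change_le[OF e N A, where J = J and x = 0 and y = x] unfolding f0_def by simp
    also have "\<dots> \<le> exp (a * \<bar>x\<bar>) * ?f x"
      using a by (intro mult_right_mono gibbs_bracket_nonneg A) (auto intro: mult_right_mono)
    finally have *: "f0 / exp (a * \<bar>x\<bar>) \<le> ?f x" by (simp add: divide_le_eq mult.commute)
    define v where "v = exp (a * \<bar>x\<bar>)"
    have v: "0 < v" by (simp add: v_def)
    \<comment> \<open>The tangent line of \<open>1 / v\<close> at \<open>v = K\<close> lies below it; its mean only involves the mean of \<open>v\<close>.\<close>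
    have "0 \<le> (1 - v / K)\<^sup>2 / v" using v by simp
    also have "\<dots> = 1 / v - (2 / K - v / K\<^sup>2)"
      using v K by (simp add: power2_eq_square field_simps)
    finally have "2 / K - v / K\<^sup>2 \<le> 1 / v" by simp
    then have "f0 * (2 / K - v / K\<^sup>2) \<le> f0 * (1 / v)" by (rule mult_left_mono) (rule f0)
    then show ?thesis using * unfolding v_def by simp
  qed
  have "f0 * (2 / K - (LINT x|\<mu>. exp (a * \<bar>x\<bar>)) / K\<^sup>2) = (LINT x|\<mu>. f0 * (2 / K - exp (a * \<bar>x\<bar>) / K\<^sup>2))"
    using int by (simp add: prob_space)
  also have "\<dots> \<le> edge_average \<mu> N r e A J"
    unfolding edge_average_def using int le
    by (intro integral_mono gibbs_bracket_upd_integrable[OF g]) auto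
  finally have 1: "f0 * (2 / K - (LINT x|\<mu>. exp (a * \<bar>x\<bar>)) / K\<^sup>2) \<le> edge_average \<mu> N r e A J" .
  have "(LINT x|\<mu>. exp (a * \<bar>x\<bar>)) / K\<^sup>2 \<le> K / K\<^sup>2"
    using good_law_exp_le[OF g] K by (intro divide_right_mono) auto
  then have "1 / K \<le> 2 / K - (LINT x|\<mu>. exp (a * \<bar>x\<bar>)) / K\<^sup>2"
    using K by (simp add: power2_eq_square)
  then have "f0 * (1 / K) \<le> f0 * (2 / K - (LINT x|\<mu>. exp (a * \<bar>x\<bar>)) / K\<^sup>2)" by (rule mult_left_mono) (rule f0)
  then have "f0 / K \<le> edge_average \<mu> N r e A J" using 1 by simp
  then show ?thesis using K unfolding f0_def by (simp add: pos_divide_le_eq mult.commute)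
qed

definition expansion_mass :: "nat \<Rightarrow> real" where
  "expansion_mass r = (\<Sum>S\<in>Pow {1..r}. \<Sum>j\<le>5 * r. \<bar>coeff (geom6 ^ r) j\<bar>)"

lemma expansion_mass_nonneg: "0 \<le> expansion_mass r"
  unfolding expansion_mass_def by (intro sum_nonneg) auto

lemma weighted_expansion_le:
  assumes "\<And>S j. S \<subseteq> {1..r} \<Longrightarrow> j \<le> 5 * r \<Longrightarrow> \<bar>w S j\<bar> \<le> B"
  shows "\<bar>\<Sum>S\<in>Pow {1..r}. \<Sum>j\<le>5 * r. coeff (geom6 ^ r) j * w S j\<bar> \<le> expansion_mass r * B"
  unfolding expansion_mass_def sum_distrib_right
  by (intro order_trans[OF sum_abs] sum_mono order_trans[OF sum_abs])
     (auto simp: abs_mult intro!: mult_left_mono assms)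

lemma divide_cube_le_divide_square: "N \<ge> 1 \<Longrightarrow> (x::real) \<ge> 0 \<Longrightarrow> x / real N ^ 3 \<le> x / (real N)\<^sup>2"
  by (intro divide_left_mono power_increasing) auto

definition swap_const :: "nat \<Rightarrow> real \<Rightarrow> real" where
  "swap_const r K = 48 * K * expansion_mass r + 1440 * remainder_const r * K"

text \<open>
  Up to a remainder of order \<open>N^-3\<close>, only differences of moments of \<open>t\<close> enter, which are of order \<open>N^-2\<close>.
\<close>

lemma edge_average_swap:
  assumes g: "good_law a K \<mu>" "good_law a K \<mu>'" and a: "2 * real r + 1 \<le> a"
    and e: "e \<in> site_pairs N" and N: "N \<ge> 1"
  shows "\<bar>edge_average \<mu> N r e A J - edge_average \<mu>' N r e A J\<bar>
    \<le> swap_const r K / (real N)\<^sup>2 * gibbs_bracket N r (J(e := 0)) (\<lambda>\<sigma>. \<bar>A \<sigma>\<bar>)"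
proof -
  let ?c = "coeff (geom6 ^ r)" and ?E = "edge_correlation N r e (J(e := 0)) A"
  let ?s = "\<lambda>\<mu>. \<Sum>S\<in>Pow {1..r}. \<Sum>j\<le>5 * r. ?c j * tanh_moment N \<mu> (card S + j) * ?E S j"
  define a0 where "a0 = gibbs_bracket N r (J(e := 0)) (\<lambda>\<sigma>. \<bar>A \<sigma>\<bar>)"
  have a0: "0 \<le> a0" unfolding a0_def by (rule gibbs_bracket_nonneg) simp
  have K: "0 \<le> K" using good_law_K_ge_1[OF g(1)] a by simp
  have "?s \<mu> - ?s \<mu>' = (\<Sum>S\<in>Pow {1..r}. \<Sum>j\<le>5 * r. ?c j *
      ((tanh_moment N \<mu> (card S + j) - tanh_moment N \<mu>' (card S + j)) * ?E S j))"
    by (simp add: sum_subtractf[symmetric] algebra_simps)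
  moreover have "\<bar>\<dots>\<bar> \<le> expansion_mass r * (48 * K / (real N)\<^sup>2 * a0)"
    unfolding a0_def
  proof (rule weighted_expansion_le, unfold abs_mult, rule mult_mono)
    show "\<bar>tanh_moment N \<mu> (card S + j) - tanh_moment N \<mu>' (card S + j)\<bar> \<le> 48 * K / (real N)\<^sup>2" for S and j :: nat
      by (rule tanh_moment_diff_le[OF g]) (use a in simp)
    show "\<bar>?E S j\<bar> \<le> gibbs_bracket N r (J(e := 0)) (\<lambda>\<sigma>. \<bar>A \<sigma>\<bar>)" if "S \<subseteq> {1..r}" for S j
      by (rule edge_correlation_abs_le[OF e that])
  qed (use K in auto)
  moreover have "720 * remainder_const r * K / real N ^ 3 * a0 \<le> 720 * remainder_const r * K / (real N)\<^sup>2 * a0"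
    using K a0 N by (intro mult_right_mono divide_cube_le_divide_square) (auto simp: remainder_const_nonneg)
  ultimately have "\<bar>edge_average \<mu> N r e A J - edge_average \<mu>' N r e A J\<bar>
     \<le> expansion_mass r * (48 * K / (real N)\<^sup>2 * a0) + 2 * (720 * remainder_const r * K / (real N)\<^sup>2 * a0)"
    using edge_average_expansion[OF g(1) a e N, of A J] edge_average_expansion[OF g(2) a e N, of A J]
    unfolding a0_def[symmetric] by linarith
  also have "\<dots> = swap_const r K / (real N)\<^sup>2 * a0"
    by (simp add: swap_const_def divide_inverse algebra_simps)
  finally show ?thesis unfolding a0_def .
qed

text \<open>
  The term of degree \<open>0\<close> of the expansion is \<open>\<langle>A\<rangle>\<^sub>0\<close> itself, and all other moments of \<open>t\<close> are \<open>O(1/N)\<close>.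
\<close>

lemma edge_average_cavity:
  assumes g: "good_law a K \<mu>" and a: "2 * real r + 1 \<le> a"
    and e: "e \<in> site_pairs N" and N: "N \<ge> 1"
  shows "\<bar>edge_average \<mu> N r e A J - gibbs_bracket N r (J(e := 0)) A\<bar>
    \<le> (expansion_mass r + 720 * remainder_const r * K) / real N * sup_norm N r A"
proof -
  let ?c = "coeff (geom6 ^ r)" and ?E = "edge_correlation N r e (J(e := 0)) A"
  define w where "w = (\<lambda>S j. (if card S + j = 0 then 0 else tanh_moment N \<mu> (card S + j)) * ?E S j)"
  define a0 where "a0 = gibbs_bracket N r (J(e := 0)) (\<lambda>\<sigma>. \<bar>A \<sigma>\<bar>)"
  have a0: "0 \<le> a0" unfolding a0_def by (rule gibbs_bracket_nonneg) simp
  have a0n: "a0 \<le> sup_norm N r A"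
    using gibbs_bracket_abs_le_const[of N r "\<lambda>\<sigma>. \<bar>A \<sigma>\<bar>" "sup_norm N r A" "J(e := 0)"]
    unfolding a0_def by (simp add: abs_le_sup_norm)
  have K: "0 \<le> K" using good_law_K_ge_1[OF g] a by simp
  have c0: "?c 0 = 1" using poly_0_coeff_0[of "geom6 ^ r"] by (simp add: poly_power)
  \<comment> \<open>The pair \<open>S = {}\<close>, \<open>j = 0\<close> is split off; \<open>w\<close> carries the rest.\<close>
  have "(\<Sum>S\<in>Pow {1..r}. \<Sum>j\<le>5 * r. ?c j * tanh_moment N \<mu> (card S + j) * ?E S j)
      = (\<Sum>S\<in>Pow {1..r}. \<Sum>j\<le>5 * r. ?c j * w S j + (if S = {} then if j = 0 then ?E S j else 0 else 0))"
    by (intro sum.cong refl) (auto simp: w_def c0 tanh_moment_0[OF g] dest: finite_subset)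
  also have "\<dots> = (\<Sum>S\<in>Pow {1..r}. \<Sum>j\<le>5 * r. ?c j * w S j)
      + (\<Sum>S\<in>Pow {1..r}. if S = {} then ?E S 0 else 0)"
    unfolding sum.distrib by (intro arg_cong2[of _ _ _ _ "(+)"] refl sum.cong) auto
  also have "(\<Sum>S\<in>Pow {1..r}. if S = {} then ?E S 0 else 0) = gibbs_bracket N r (J(e := 0)) A"
    by (simp add: sum.delta edge_correlation_def)
  finally have s: "(\<Sum>S\<in>Pow {1..r}. \<Sum>j\<le>5 * r. ?c j * tanh_moment N \<mu> (card S + j) * ?E S j)
     = (\<Sum>S\<in>Pow {1..r}. \<Sum>j\<le>5 * r. ?c j * w S j) + gibbs_bracket N r (J(e := 0)) A" .
  have "\<bar>\<Sum>S\<in>Pow {1..r}. \<Sum>j\<le>5 * r. ?c j * w S j\<bar> \<le> expansion_mass r * (1 / real N * a0)"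
    unfolding w_def a0_def
  proof (rule weighted_expansion_le, unfold abs_mult, rule mult_mono)
    show "\<bar>if card S + j = 0 then 0 else tanh_moment N \<mu> (card S + j)\<bar> \<le> 1 / real N" for S and j :: nat
      using tanh_moment_le[OF g, of "card S + j" N] by simp
    show "\<bar>?E S j\<bar> \<le> gibbs_bracket N r (J(e := 0)) (\<lambda>\<sigma>. \<bar>A \<sigma>\<bar>)" if "S \<subseteq> {1..r}" for S j
      by (rule edge_correlation_abs_le[OF e that])
  qed auto
  moreover have "720 * remainder_const r * K / real N ^ 3 * a0 \<le> 720 * remainder_const r * K / real N ^ 1 * a0"
    using K a0 N
    by (intro mult_right_mono divide_left_mono power_increasing) (auto simp: remainder_const_nonneg)
  ultimately have "\<bar>edge_average \<mu> N r e A J - gibbs_bracket N r (J(e := 0)) A\<bar>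
     \<le> expansion_mass r * (1 / real N * a0) + 720 * remainder_const r * K / real N ^ 1 * a0"
    using edge_average_expansion[OF g a e N, of A J] unfolding s a0_def[symmetric] by linarith
  also have "\<dots> = (expansion_mass r + 720 * remainder_const r * K) / real N * a0"
    by (simp add: add_divide_distrib distrib_right)
  also have "\<dots> \<le> (expansion_mass r + 720 * remainder_const r * K) / real N * sup_norm N r A"
    using a0n K by (intro mult_left_mono) (auto simp: expansion_mass_nonneg remainder_const_nonneg)
  finally show ?thesis .
qed

section \<open>Mixtures, bounded laws and the Gaussian law\<close>

definition mixture :: "real \<Rightarrow> real measure \<Rightarrow> real measure \<Rightarrow> real measure" where
  "mixture p \<nu> \<gamma> = measure_pmf (bernoulli_pmf p) \<bind> (\<lambda>b. if b then \<nu> else \<gamma>)"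

context
  fixes \<nu> \<gamma> :: "real measure" and p :: real
  assumes prob: "prob_space \<nu>" "prob_space \<gamma>" and sets: "sets \<nu> = sets borel" "sets \<gamma> = sets borel"
    and p: "0 \<le> p" "p \<le> 1"
begin

lemma mixture_kernel:
  "(\<lambda>b. if b then \<nu> else \<gamma>) \<in> measurable (measure_pmf (bernoulli_pmf p)) (subprob_algebra borel)"
  using prob sets by (auto simp: space_subprob_algebra prob_space_imp_subprob_space)

lemma sets_mixture: "sets (mixture p \<nu> \<gamma>) = sets borel"
  unfolding mixture_def by (rule sets_bind[OF sets_kernel[OF mixture_kernel]]) auto

lemma nn_integral_mixture:
  assumes "f \<in> borel_measurable borel"
  shows "(\<integral>\<^sup>+ x. f x \<partial>mixture p \<nu> \<gamma>) = (\<integral>\<^sup>+ x. f x \<partial>\<nu>) * ennreal p + (\<integral>\<^sup>+ x. f x \<partial>\<gamma>) * ennreal (1 - p)"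
  unfolding mixture_def nn_integral_bind[OF assms mixture_kernel] using p by simp

lemma emeasure_mixture:
  assumes "X \<in> sets borel"
  shows "emeasure (mixture p \<nu> \<gamma>) X = emeasure \<nu> X * ennreal p + emeasure \<gamma> X * ennreal (1 - p)"
  using nn_integral_mixture[of "indicator X"] assms by (simp add: sets_mixture sets)

lemma ennreal_convex_1: "ennreal p + ennreal (1 - p) = 1"
  using p by (simp flip: ennreal_plus)

lemma prob_space_mixture: "prob_space (mixture p \<nu> \<gamma>)"
proof
  interpret \<nu>: prob_space \<nu> by (rule prob)
  interpret \<gamma>: prob_space \<gamma> by (rule prob)
  have s: "space (mixture p \<nu> \<gamma>) = UNIV" "space \<nu> = UNIV" "space \<gamma> = UNIV"
    using sets_eq_imp_space_eq[OF sets_mixture] sets_eq_imp_space_eq[OF sets(1)] sets_eq_imp_space_eq[OF sets(2)]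
    by auto
  show "emeasure (mixture p \<nu> \<gamma>) (space (mixture p \<nu> \<gamma>)) = 1"
    unfolding s using \<nu>.emeasure_space_1 \<gamma>.emeasure_space_1 by (simp add: s emeasure_mixture ennreal_convex_1)
qed

lemma integral_mixture:
  fixes f :: "real \<Rightarrow> real"
  assumes f: "f \<in> borel_measurable borel" "\<And>x. \<bar>f x\<bar> \<le> B"
  shows "(LINT x|mixture p \<nu> \<gamma>. f x) = p * (LINT x|\<nu>. f x) + (1 - p) * (LINT x|\<gamma>. f x)"
proof -
  have "(LINT x|mixture p \<nu> \<gamma>. f x)
      = (LINT b|measure_pmf (bernoulli_pmf p). LINT x|(if b then \<nu> else \<gamma>). f x)"
    unfolding mixture_def
  proof (rule integral_bind[where K = borel and B = B and B' = 1])
    show "\<bar>f x\<bar> \<le> B" for x using f by simp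
    show "AE b in measure_pmf (bernoulli_pmf p).
        emeasure (if b then \<nu> else \<gamma>) (space (if b then \<nu> else \<gamma>)) \<le> ennreal 1"
      using prob by (simp add: prob_space.emeasure_space_1)
    show "finite_measure (measure_pmf (bernoulli_pmf p))" by unfold_locales
  qed (use f mixture_kernel in auto)
  also have "\<dots> = p * (LINT x|\<nu>. f x) + (1 - p) * (LINT x|\<gamma>. f x)"
    using p by simp
  finally show ?thesis .
qed

end

lemma measure_eq_of_borel:
  "sets M = sets borel \<Longrightarrow> sets M' = sets borel \<Longrightarrow>
    (\<And>X. X \<in> sets borel \<Longrightarrow> emeasure M X = emeasure M' X) \<Longrightarrow> M = M'"
  by (rule measure_eqI) auto

lemma mixture_0: "prob_space \<nu> \<Longrightarrow> prob_space \<gamma> \<Longrightarrow> sets \<nu> = sets borel \<Longrightarrow> sets \<gamma> = sets borel \<Longrightarrow> mixture 0 \<nu> \<gamma> = \<gamma>"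
  by (rule measure_eq_of_borel) (auto simp: sets_mixture emeasure_mixture)

lemma mixture_1: "prob_space \<nu> \<Longrightarrow> prob_space \<gamma> \<Longrightarrow> sets \<nu> = sets borel \<Longrightarrow> sets \<gamma> = sets borel \<Longrightarrow> mixture 1 \<nu> \<gamma> = \<nu>"
  by (rule measure_eq_of_borel) (auto simp: sets_mixture emeasure_mixture)

lemma good_law_mixture:
  assumes g: "good_law a K \<nu>" "good_law a K \<gamma>" and p: "0 \<le> p" "p \<le> 1"
  shows "good_law a K (mixture p \<nu> \<gamma>)"
proof -
  note ps = good_law_prob[OF g(1)] good_law_prob[OF g(2)] good_law_sets[OF g(1)] good_law_sets[OF g(2)] p
  note [simp] = sets_mixture[OF ps] good_law_sets[OF g(1)] good_law_sets[OF g(2)]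
  note sp = good_law_space[OF g(1)] good_law_space[OF g(2)] sets_eq_imp_space_eq[OF sets_mixture[OF ps]]
  have meas: "uminus \<in> measurable M (borel :: real measure)" if "sets M = sets borel" for M :: "real measure"
    using that by (simp cong: measurable_cong_sets)
  have "distr (mixture p \<nu> \<gamma>) borel uminus = mixture p \<nu> \<gamma>"
  proof (rule measure_eq_of_borel)
    fix X :: "real set" assume X: "X \<in> sets borel"
    have Y: "uminus -` X \<in> sets (borel :: real measure)"
      using measurable_sets[OF meas[OF refl] X] by simp
    have "emeasure \<mu> (uminus -` X) = emeasure \<mu> X" if "good_law a K \<mu>" for \<mu>
    proof -
      have "emeasure \<mu> X = emeasure (distr \<mu> borel uminus) X" using that by (simp add: good_law_def)
      also have "\<dots> = emeasure \<mu> (uminus -` X)"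
        using X by (simp add: emeasure_distr[OF meas[OF good_law_sets[OF that]]] good_law_space[OF that])
      finally show ?thesis ..
    qed
    from this[OF g(1)] this[OF g(2)]
    show "emeasure (distr (mixture p \<nu> \<gamma>) borel uminus) X = emeasure (mixture p \<nu> \<gamma>) X"
      using X Y by (simp add: emeasure_distr[OF meas] sp emeasure_mixture[OF ps])
  qed auto
  moreover have "(\<integral>\<^sup>+ x. ennreal (x\<^sup>2) \<partial>mixture p \<nu> \<gamma>) = 1"
    using g p by (simp add: nn_integral_mixture[OF ps] good_law_def ennreal_convex_1[OF ps])
  moreover have "(\<integral>\<^sup>+ x. ennreal (exp (a * \<bar>x\<bar>)) \<partial>mixture p \<nu> \<gamma>) \<le> ennreal K"
  proof -
    have "(\<integral>\<^sup>+ x. ennreal (exp (a * \<bar>x\<bar>)) \<partial>mixture p \<nu> \<gamma>) \<le> ennreal K * ennreal p + ennreal K * ennreal (1 - p)"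
      using g by (auto simp: nn_integral_mixture[OF ps] good_law_def intro!: add_mono mult_right_mono)
    also have "\<dots> = ennreal K" using p by (simp flip: distrib_left add: ennreal_convex_1[OF ps])
    finally show ?thesis .
  qed
  ultimately show ?thesis by (simp add: good_law_def prob_space_mixture[OF ps])
qed

lemma good_law_admissible:
  assumes \<nu>: "admissible_law b \<nu>" and a: "0 \<le> a"
  shows "good_law a (exp (a * b)) \<nu>"
proof -
  interpret prob_space \<nu> using \<nu> by (simp add: admissible_law_def)
  have s [measurable_cong]: "sets \<nu> = sets borel" using \<nu> by (simp add: admissible_law_def)
  have 2: "(LINT x|\<nu>. x\<^sup>2) = 1" using \<nu> by (simp add: admissible_law_def)
  \<comment> \<open>A function that is not integrable has Bochner integral \<open>0\<close>, so the value \<open>1\<close> forces integrability.\<close>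
  then have "integrable \<nu> (\<lambda>x. x\<^sup>2)" using not_integrable_integral_eq by force
  from nn_integral_eq_integral[OF this] 2 have sq: "(\<integral>\<^sup>+ x. ennreal (x\<^sup>2) \<partial>\<nu>) = 1" by simp
  have "AE x in \<nu>. x \<in> {-b..b}"
    using \<nu> by (intro AE_I[of _ _ "- {-b..b}"]) (auto simp: admissible_law_def)
  then have "(\<integral>\<^sup>+ x. ennreal (exp (a * \<bar>x\<bar>)) \<partial>\<nu>) \<le> (\<integral>\<^sup>+ x. ennreal (exp (a * b)) \<partial>\<nu>)"
    using a by (intro nn_integral_mono_AE) (erule eventually_mono, auto intro!: ennreal_leI mult_left_mono)
  also have "\<dots> = ennreal (exp (a * b))" by (simp add: emeasure_space_1)
  finally show ?thesis using \<nu> sq by (simp add: good_law_def admissible_law_def)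
qed

lemma normal_density_exp_tilt: "std_normal_density x * exp (a * x) = exp (a\<^sup>2 / 2) * normal_density a 1 x"
  by (simp add: normal_density_def exp_add[symmetric] power2_eq_square field_simps)

text \<open>
  The constant comes from \<open>exp (a \<bar>x\<bar>) \<le> exp (a x) + exp (- a x)\<close>: multiplying the density by \<open>exp (c x)\<close>
  gives \<open>exp (c\<^sup>2 / 2)\<close> times the density shifted by \<open>c\<close>.
\<close>

lemma good_law_gaussian: "good_law a (2 * exp (a\<^sup>2 / 2)) std_gaussian"
proof -
  interpret prob_space std_gaussian
    unfolding std_gaussian_def by (rule prob_space_normal_density) simp
  have s [simp, measurable_cong]: "sets std_gaussian = sets borel" by (simp add: std_gaussian_def)
  have "distributed std_gaussian lborel (\<lambda>x. x) std_normal_density"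
    unfolding distributed_def std_gaussian_def by (auto simp: distr_id2)
  from normal_density_affine[OF this, of "-1" 0]
  have d: "distributed std_gaussian lborel uminus std_normal_density" by simp
  have "distr std_gaussian borel uminus = distr std_gaussian lborel uminus"
    by (intro distr_cong) auto
  also have "\<dots> = std_gaussian" using d unfolding distributed_def std_gaussian_def by simp
  finally have sym: "distr std_gaussian borel uminus = std_gaussian" .
  have 2: "(\<integral>\<^sup>+ x. ennreal (x\<^sup>2) \<partial>std_gaussian) = 1"
  proof -
    have "has_bochner_integral lborel (\<lambda>x. std_normal_density x * x\<^sup>2) 1"
      using std_normal_moment_even[of 1] by (simp add: fact_numeral)
    then have "(\<integral>\<^sup>+ x. ennreal (std_normal_density x * x\<^sup>2) \<partial>lborel) = ennreal 1"
      by (subst nn_integral_eq_integral) (auto simp: has_bochner_integral_iff)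
    then show ?thesis by (simp add: std_gaussian_def nn_integral_density ennreal_mult')
  qed
  have exp_int: "(\<integral>\<^sup>+ x. ennreal (exp (c * x)) \<partial>std_gaussian) = ennreal (exp (c\<^sup>2 / 2))" for c
  proof -
    have "(\<integral>\<^sup>+ x. ennreal (exp (c * x)) \<partial>std_gaussian)
        = (\<integral>\<^sup>+ x. ennreal (exp (c\<^sup>2 / 2)) * ennreal (normal_density c 1 x) \<partial>lborel)"
      by (simp add: std_gaussian_def nn_integral_density normal_density_exp_tilt flip: ennreal_mult')
    also have "\<dots> = ennreal (exp (c\<^sup>2 / 2)) * (\<integral>\<^sup>+ x. ennreal (normal_density c 1 x) \<partial>lborel)"
      by (rule nn_integral_cmult) simp
    also have "(\<integral>\<^sup>+ x. ennreal (normal_density c 1 x) \<partial>lborel) = 1"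
      by (subst nn_integral_eq_integral) auto
    finally show ?thesis by simp
  qed
  have "(\<integral>\<^sup>+ x. ennreal (exp (a * \<bar>x\<bar>)) \<partial>std_gaussian)
      \<le> (\<integral>\<^sup>+ x. ennreal (exp (a * x)) + ennreal (exp (- a * x)) \<partial>std_gaussian)"
    by (intro nn_integral_mono) (auto simp: abs_if ennreal_plus[symmetric] simp del: ennreal_plus intro!: ennreal_leI)
  also have "\<dots> = ennreal (exp (a\<^sup>2 / 2)) + ennreal (exp ((- a)\<^sup>2 / 2))"
    unfolding exp_int[symmetric] by (rule nn_integral_add) (simp_all add: measurable_cong_sets[OF s refl])
  also have "\<dots> = ennreal (2 * exp (a\<^sup>2 / 2))" by (simp flip: ennreal_plus)
  finally have "(\<integral>\<^sup>+ x. ennreal (exp (a * \<bar>x\<bar>)) \<partial>std_gaussian) \<le> ennreal (2 * exp (a\<^sup>2 / 2))" .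
  then show ?thesis using sym 2 prob_space_axioms by (simp add: good_law_def)
qed

lemma good_law_mono: "good_law a K \<mu> \<Longrightarrow> K \<le> K' \<Longrightarrow> good_law a K' \<mu>"
  unfolding good_law_def by (auto intro: order_trans ennreal_leI)

section \<open>Resampling one coordinate of a product measure\<close>

lemma sets_PiM_borel:
  "(\<And>i. sets (M i) = sets borel) \<Longrightarrow> sets (Pi\<^sub>M I M) = sets (Pi\<^sub>M I (\<lambda>_. borel :: real measure))"
  by (intro sets_PiM_cong) auto

lemma product_integrable_bounded:
  fixes h :: "('i \<Rightarrow> real) \<Rightarrow> real" and M :: "'i \<Rightarrow> real measure"
  assumes M: "\<And>i. prob_space (M i)" "\<And>i. sets (M i) = sets borel"
    and h: "h \<in> borel_measurable (Pi\<^sub>M I (\<lambda>_. borel))" "\<And>J. \<bar>h J\<bar> \<le> B"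
  shows "integrable (Pi\<^sub>M I M) h"
proof -
  interpret prob_space "Pi\<^sub>M I M" using M(1) by (rule prob_space_PiM)
  have "h \<in> borel_measurable (Pi\<^sub>M I M)"
    using h(1) unfolding measurable_cong_sets[OF sets_PiM_borel[of M I, OF M(2)] refl] .
  then show ?thesis using h(2) by (intro integrable_const_bound[of _ B]) auto
qed

text \<open>
  Replacing the law of one coordinate amounts to drawing the point from the old product measure and
  then overwriting that coordinate by an independent value with the new law.
\<close>

lemma product_resample:
  fixes f :: "('i \<Rightarrow> real) \<Rightarrow> real" and M :: "'i \<Rightarrow> real measure"
  assumes I: "finite I" "e \<in> I"
    and M: "\<And>i. prob_space (M i)" "\<And>i. sets (M i) = sets borel"
    and \<mu>: "prob_space \<mu>" "sets \<mu> = sets borel"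
    and f: "f \<in> borel_measurable (Pi\<^sub>M I (\<lambda>_. borel))" "\<And>J. \<bar>f J\<bar> \<le> B"
  shows "(LINT J|Pi\<^sub>M I (M(e := \<mu>)). f J) = (LINT J|Pi\<^sub>M I M. LINT x|\<mu>. f (J(e := x)))"
    and "(\<lambda>J. LINT x|\<mu>. f (J(e := x))) \<in> borel_measurable (Pi\<^sub>M I (\<lambda>_. borel))"
proof -
  define I' where "I' = I - {e}"
  have I': "finite I'" "e \<notin> I'" "I = insert e I'" using I by (auto simp: I'_def)
  let ?M = "M(e := \<mu>)"
  have M': "prob_space (?M i)" "sets (?M i) = sets borel" for i using M \<mu> by auto
  interpret M: product_sigma_finite M
    using M(1) by (intro product_sigma_finite.intro prob_space_imp_sigma_finite)
  interpret M': product_sigma_finite ?M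
    using M'(1) by (intro product_sigma_finite.intro prob_space_imp_sigma_finite)
  interpret P: prob_space \<mu> by (rule \<mu>)
  have B: "0 \<le> B" using f(2)[of undefined] by linarith
  have meas_upd: "(\<lambda>(J, x). J(e := x)) \<in> measurable (Pi\<^sub>M I (\<lambda>_. borel) \<Otimes>\<^sub>M \<mu>) (Pi\<^sub>M I (\<lambda>_. borel))"
  proof -
    have eq: "measurable (Pi\<^sub>M I (\<lambda>_. borel) \<Otimes>\<^sub>M \<mu>) N = measurable (Pi\<^sub>M I (\<lambda>_. borel) \<Otimes>\<^sub>M (borel :: real measure)) N"
      for N :: "('i \<Rightarrow> real) measure"
      by (intro measurable_cong_sets sets_pair_measure_cong refl \<mu>)
    show ?thesis unfolding eq case_prod_unfold
      by (rule measurable_fun_upd[of I I]) (use I in auto)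
  qed
  have m2: "(\<lambda>(J, x). f (J(e := x))) \<in> borel_measurable (Pi\<^sub>M I (\<lambda>_. borel) \<Otimes>\<^sub>M \<mu>)"
    using measurable_compose[OF meas_upd f(1)] by (simp add: case_prod_unfold)
  show g: "(\<lambda>J. LINT x|\<mu>. f (J(e := x))) \<in> borel_measurable (Pi\<^sub>M I (\<lambda>_. borel))"
    by (rule P.borel_measurable_lebesgue_integral[OF m2])
  have gB: "\<bar>LINT x|\<mu>. f (J(e := x))\<bar> \<le> B" for J
  proof (cases "integrable \<mu> (\<lambda>x. f (J(e := x)))")
    case True
    have "\<bar>LINT x|\<mu>. f (J(e := x))\<bar> \<le> (LINT x|\<mu>. \<bar>f (J(e := x))\<bar>)" by (rule integral_abs_bound)
    also have "\<dots> \<le> (LINT x|\<mu>. B)" using True f(2) by (intro integral_mono) auto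
    finally show ?thesis by (simp add: P.prob_space)
  qed (simp add: not_integrable_integral_eq B)
  have "(LINT J|Pi\<^sub>M I ?M. f J) = (LINT J|Pi\<^sub>M I' ?M. LINT x|\<mu>. f (J(e := x)))"
    using M'.product_integral_insert[OF I'(1,2), of f] product_integrable_bounded[OF M' f] unfolding I'(3) by simp
  also have "Pi\<^sub>M I' ?M = Pi\<^sub>M I' M" using I'(2) by (intro PiM_cong) auto
  also have "(LINT J|Pi\<^sub>M I' M. LINT x|\<mu>. f (J(e := x)))
      = (LINT J|Pi\<^sub>M I' M. LINT y|M e. LINT x|\<mu>. f ((J(e := y))(e := x)))"
    using M(1) by (simp add: prob_space.prob_space)
  also have "\<dots> = (LINT J|Pi\<^sub>M I M. LINT x|\<mu>. f (J(e := x)))"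
    using M.product_integral_insert[OF I'(1,2), of "\<lambda>J. LINT x|\<mu>. f (J(e := x))"]
      product_integrable_bounded[OF M g gB] unfolding I'(3) by simp
  finally show "(LINT J|Pi\<^sub>M I ?M. f J) = (LINT J|Pi\<^sub>M I M. LINT x|\<mu>. f (J(e := x)))" .
qed

section \<open>Multiplicative comparison of two laws\<close>

text \<open>
  The disorder average with a law for each edge; both the edge-by-edge replacement and the
  interpolation pass through such averages.
\<close>

definition hybrid_average ::
  "(nat \<times> nat \<Rightarrow> real measure) \<Rightarrow> nat \<Rightarrow> nat \<Rightarrow> ((nat \<Rightarrow> nat \<Rightarrow> real) \<Rightarrow> real) \<Rightarrow> real" where
  "hybrid_average M N r A = (LINT J|(\<Pi>\<^sub>M p\<in>site_pairs N. M p). gibbs_bracket N r J A)"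

lemma hybrid_average_const: "hybrid_average (\<lambda>_. \<mu>) N r A = disorder_average \<mu> N r A"
  by (simp add: hybrid_average_def disorder_average_def)

lemma gibbs_bracket_coupling_measurable:
  "(\<lambda>J. gibbs_bracket N r J A) \<in> borel_measurable (Pi\<^sub>M (site_pairs N) (\<lambda>_. borel))"
  by (rule gibbs_bracket_measurable) (rule measurable_component_singleton)

lemma gibbs_bracket_cavity_measurable:
  "(\<lambda>J. gibbs_bracket N r (J(e := c)) A) \<in> borel_measurable (Pi\<^sub>M (site_pairs N) (\<lambda>_. borel))"
proof (rule gibbs_bracket_measurable)
  fix p assume "p \<in> site_pairs N"
  then show "(\<lambda>J. (J(e := c)) p) \<in> borel_measurable (Pi\<^sub>M (site_pairs N) (\<lambda>_. borel))"
    by (cases "p = e") auto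
qed

context
  fixes M :: "nat \<times> nat \<Rightarrow> real measure" and a K :: real
  assumes good: "\<And>i. good_law a K (M i)"
begin

lemmas good_M = good_law_prob[OF good] good_law_sets[OF good]

lemma integrable_coupling:
  fixes h :: "(nat \<times> nat \<Rightarrow> real) \<Rightarrow> real"
  assumes "h \<in> borel_measurable (Pi\<^sub>M (site_pairs N) (\<lambda>_. borel))" "\<And>J. \<bar>h J\<bar> \<le> B"
  shows "integrable (Pi\<^sub>M (site_pairs N) M) h"
  by (rule product_integrable_bounded[OF good_M assms])

lemma integrable_gibbs_bracket: "integrable (Pi\<^sub>M (site_pairs N) M) (\<lambda>J. gibbs_bracket N r J A)"
  by (rule integrable_coupling[OF gibbs_bracket_coupling_measurable gibbs_bracket_abs_le_sup_norm])

lemma integrable_gibbs_bracket_cavity: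
  "integrable (Pi\<^sub>M (site_pairs N) M) (\<lambda>J. gibbs_bracket N r (J(e := c)) A)"
  by (rule integrable_coupling[OF gibbs_bracket_cavity_measurable gibbs_bracket_abs_le_sup_norm])

lemma hybrid_average_resample:
  assumes "e \<in> site_pairs N" "good_law a K \<mu>"
  shows "hybrid_average (M(e := \<mu>)) N r A = (LINT J|Pi\<^sub>M (site_pairs N) M. edge_average \<mu> N r e A J)"
  unfolding hybrid_average_def edge_average_def
  by (rule product_resample(1)[OF finite_site_pairs assms(1) good_M good_law_prob[OF assms(2)]
        good_law_sets[OF assms(2)] gibbs_bracket_coupling_measurable gibbs_bracket_abs_le_sup_norm])

lemma edge_average_abs_le:
  assumes "good_law a K \<mu>"
  shows "\<bar>edge_average \<mu> N r e A J\<bar> \<le> sup_norm N r A"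
proof -
  interpret prob_space \<mu> by (rule good_law_prob[OF assms])
  have "\<bar>edge_average \<mu> N r e A J\<bar> \<le> (LINT x|\<mu>. \<bar>gibbs_bracket N r (J(e := x)) A\<bar>)"
    unfolding edge_average_def by (rule integral_abs_bound)
  also have "\<dots> \<le> (LINT x|\<mu>. sup_norm N r A)"
    by (intro integral_mono integrable_abs gibbs_bracket_upd_integrable[OF assms] gibbs_bracket_abs_le_sup_norm) simp
  finally show ?thesis by (simp add: prob_space)
qed

lemma integrable_edge_average:
  assumes "e \<in> site_pairs N" "good_law a K \<mu>"
  shows "integrable (Pi\<^sub>M (site_pairs N) M) (edge_average \<mu> N r e A)"
proof (rule integrable_coupling[OF _ edge_average_abs_le[OF assms(2)]])
  show "edge_average \<mu> N r e A \<in> borel_measurable (Pi\<^sub>M (site_pairs N) (\<lambda>_. borel))"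
    unfolding edge_average_def
    by (rule product_resample(2)[OF finite_site_pairs assms(1) good_M good_law_prob[OF assms(2)]
          good_law_sets[OF assms(2)] gibbs_bracket_coupling_measurable gibbs_bracket_abs_le_sup_norm])
qed

text \<open>
  The error of \<open>edge_average_swap\<close> is a multiple of \<open>\<langle>A\<rangle>\<^sub>0\<close>, which \<open>cavity_le_edge_average\<close> bounds by a
  multiple of the average itself; this makes the estimate multiplicative.
\<close>

lemma hybrid_average_swap_le:
  assumes g: "good_law a K \<mu>" "good_law a K \<mu>'" and a: "2 * real r + 1 \<le> a"
    and e: "e \<in> site_pairs N" and N: "N \<ge> 1"
    and A: "\<And>\<sigma>. \<sigma> \<in> replica_configs N r \<Longrightarrow> 0 \<le> A \<sigma>"
  shows "hybrid_average (M(e := \<mu>)) N r A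
     \<le> (1 + swap_const r K * K / (real N)\<^sup>2) * hybrid_average (M(e := \<mu>')) N r A"
proof -
  let ?c = "swap_const r K / (real N)\<^sup>2"
  have K: "1 \<le> K" using good_law_K_ge_1[OF g(1)] a by simp
  have c: "0 \<le> ?c"
    using K by (simp add: swap_const_def expansion_mass_nonneg remainder_const_nonneg)
  have "edge_average \<mu> N r e A J \<le> (1 + swap_const r K * K / (real N)\<^sup>2) * edge_average \<mu>' N r e A J" for J
  proof -
    have "gibbs_bracket N r (J(e := 0)) (\<lambda>\<sigma>. \<bar>A \<sigma>\<bar>) = gibbs_bracket N r (J(e := 0)) A"
      using A by (intro gibbs_bracket_cong) auto
    then have "edge_average \<mu> N r e A J \<le> edge_average \<mu>' N r e A J + ?c * gibbs_bracket N r (J(e := 0)) A"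
      using edge_average_swap[OF g a e N, of A J] by simp
    also have "?c * gibbs_bracket N r (J(e := 0)) A \<le> ?c * (K * edge_average \<mu>' N r e A J)"
      using c a by (intro mult_left_mono cavity_le_edge_average[OF g(2) _ e N A]) auto
    finally show ?thesis by (simp add: algebra_simps)
  qed
  then have "(LINT J|Pi\<^sub>M (site_pairs N) M. edge_average \<mu> N r e A J)
     \<le> (LINT J|Pi\<^sub>M (site_pairs N) M. (1 + swap_const r K * K / (real N)\<^sup>2) * edge_average \<mu>' N r e A J)"
    by (intro integral_mono integrable_mult_right integrable_edge_average e g)
  then show ?thesis unfolding hybrid_average_resample[OF e g(1)] hybrid_average_resample[OF e g(2)] by simp
qed

end

lemma hybrid_average_nonneg:
  assumes "\<And>\<sigma>. \<sigma> \<in> replica_configs N r \<Longrightarrow> 0 \<le> A \<sigma>"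
  shows "0 \<le> hybrid_average M N r A"
  unfolding hybrid_average_def by (intro Bochner_Integration.integral_nonneg gibbs_bracket_nonneg assms)

lemma hybrid_average_cong:
  "(\<And>p. p \<in> site_pairs N \<Longrightarrow> M p = M' p) \<Longrightarrow> hybrid_average M N r A = hybrid_average M' N r A"
  unfolding hybrid_average_def by (simp cong: PiM_cong)

text \<open>
  The edges are switched from \<open>\<mu>'\<close> to \<open>\<mu>\<close> one at a time.  At most \<open>N^2\<close> factors \<open>1 + c / N^2\<close> multiply to
  at most \<open>exp c\<close>.  The hypotheses are symmetric in the two laws, so the reverse inequality is an
  instance as well.
\<close>

lemma disorder_average_comparison:
  assumes g: "good_law a K \<mu>" "good_law a K \<mu>'" and a: "2 * real r + 1 \<le> a" and N: "N \<ge> 1"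
    and A: "\<And>\<sigma>. \<sigma> \<in> replica_configs N r \<Longrightarrow> 0 \<le> A \<sigma>"
  shows "disorder_average \<mu> N r A \<le> exp (swap_const r K * K) * disorder_average \<mu>' N r A"
proof -
  define d where "d = swap_const r K * K / (real N)\<^sup>2"
  have K: "1 \<le> K" using good_law_K_ge_1[OF g(1)] a by simp
  have d: "0 \<le> d"
    using K by (simp add: d_def swap_const_def expansion_mass_nonneg remainder_const_nonneg)
  let ?M = "\<lambda>S p. if p \<in> S then \<mu> else \<mu>'"
  have "hybrid_average (?M S) N r A \<le> (1 + d) ^ card S * hybrid_average (\<lambda>_. \<mu>') N r A"
    if "finite S" "S \<subseteq> site_pairs N" for S
    using that
  proof (induction S rule: finite_induct)
    case empty then show ?case by simp
  next
    case (insert e S)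
    have M: "?M (insert e S) = (?M S)(e := \<mu>)" "(?M S)(e := \<mu>') = ?M S" using insert.hyps by auto
    have "hybrid_average (?M (insert e S)) N r A \<le> (1 + d) * hybrid_average (?M S) N r A"
      using hybrid_average_swap_le[of a K "?M S", OF _ g a _ N A, of e] g insert.prems
      unfolding M d_def by auto
    also have "\<dots> \<le> (1 + d) * ((1 + d) ^ card S * hybrid_average (\<lambda>_. \<mu>') N r A)"
      using insert d by (intro mult_left_mono) auto
    finally show ?case using insert.hyps by (simp add: mult.assoc)
  qed
  from this[of "site_pairs N"]
  have "hybrid_average (\<lambda>_. \<mu>) N r A \<le> (1 + d) ^ card (site_pairs N) * hybrid_average (\<lambda>_. \<mu>') N r A"
    using hybrid_average_cong[of N "?M (site_pairs N)" "\<lambda>_. \<mu>" r A] by simp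
  also have "\<dots> \<le> exp (swap_const r K * K) * hybrid_average (\<lambda>_. \<mu>') N r A"
  proof (rule mult_right_mono)
    have "(1 + d) ^ card (site_pairs N) \<le> exp d ^ card (site_pairs N)"
      using d by (intro power_mono exp_ge_add_one_self) auto
    also have "\<dots> = exp (real (card (site_pairs N)) * d)" by (simp add: exp_of_nat_mult)
    also have "real (card (site_pairs N)) * d \<le> real (N\<^sup>2) * d"
      using d card_site_pairs_le by (intro mult_right_mono) (simp_all only: of_nat_le_iff)
    also have "real (N\<^sup>2) * d = swap_const r K * K" using N by (simp add: d_def)
    finally show "(1 + d) ^ card (site_pairs N) \<le> exp (swap_const r K * K)" by simp
  qed (rule hybrid_average_nonneg[OF A])
  finally show ?thesis unfolding hybrid_average_const .
qed

section \<open>Multi-affine functions on the diagonal\<close>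

text \<open>
  Along the diagonal, the derivative of a function that is affine in each coordinate is the sum of
  its partial derivatives, and a partial derivative is the difference of the values at \<open>1\<close> and \<open>0\<close>.
  The induction is over the set \<open>S\<close> of coordinates that move, the others being kept at \<open>q\<close>.
\<close>

lemma multiaffine_diagonal_derivative:
  fixes g :: "('i \<Rightarrow> real) \<Rightarrow> real"
  assumes S: "finite S" and t: "t \<in> {0..1}"
    and aff: "\<And>e q u. e \<in> S \<Longrightarrow> (\<And>i. q i \<in> {0..1}) \<Longrightarrow> u \<in> {0..1} \<Longrightarrow>
        g (q(e := u)) = u * g (q(e := 1)) + (1 - u) * g (q(e := 0))"
    and q: "\<And>i. q i \<in> {0..1}"
  defines "d \<equiv> \<lambda>q i. if i \<in> S then t else q i"
  shows "((\<lambda>p. g (\<lambda>i. if i \<in> S then p else q i)) has_real_derivative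
           (\<Sum>e\<in>S. g ((d q)(e := 1)) - g ((d q)(e := 0)))) (at t within {0..1})"
  using S aff q unfolding d_def
proof (induction S arbitrary: q rule: finite_induct)
  case empty then show ?case by simp
next
  case (insert e S)
  let ?G = "\<lambda>q p. g (\<lambda>i. if i \<in> S then p else q i)"
  let ?d = "\<lambda>q i. if i \<in> S then t else q i"
  let ?D = "\<lambda>q. \<Sum>e\<in>S. g ((?d q)(e := 1)) - g ((?d q)(e := 0))"
  have q01: "(q(e := u)) i \<in> {0..1}" if "u \<in> {0..1}" for u i using that insert.prems(2)[of i] by auto
  have IH: "(?G (q(e := u)) has_real_derivative ?D (q(e := u))) (at t within {0..1})"
    if "u \<in> {0..1}" for u
  proof (rule insert.IH)
    show "g (q'(e' := v)) = v * g (q'(e' := 1)) + (1 - v) * g (q'(e' := 0))"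
      if "e' \<in> S" "\<And>i. q' i \<in> {0..1}" "v \<in> {0..1}" for e' q' v
      by (rule insert.prems(1)) (use that in blast)+
  qed (rule q01[OF that])
  have upd: "(\<lambda>i. if i \<in> insert e S then p else q i) = (\<lambda>i. if i \<in> S then p else q i)(e := p)" for p
    by auto
  have upd': "(\<lambda>i. if i \<in> S then p else q i)(e := v) = (\<lambda>i. if i \<in> S then p else (q(e := v)) i)" for p v
    using insert.hyps(2) by auto
  have split: "g (\<lambda>i. if i \<in> insert e S then p else q i) = p * ?G (q(e := 1)) p + (1 - p) * ?G (q(e := 0)) p"
    if "p \<in> {0..1}" for p
    unfolding upd upd'[symmetric]
    using that insert.prems(2) by (intro insert.prems(1)) (simp_all del: atLeastAtMost_iff)
  have "((\<lambda>p. p * ?G (q(e := 1)) p + (1 - p) * ?G (q(e := 0)) p) has_real_derivative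
      (1 * ?G (q(e := 1)) t + ?D (q(e := 1)) * t + ((0 - 1) * ?G (q(e := 0)) t + ?D (q(e := 0)) * (1 - t))))
      (at t within {0..1})"
    by (intro DERIV_add DERIV_mult DERIV_diff DERIV_ident DERIV_const IH) auto
  also have "1 * ?G (q(e := 1)) t + ?D (q(e := 1)) * t + ((0 - 1) * ?G (q(e := 0)) t + ?D (q(e := 0)) * (1 - t))
      = (\<Sum>e'\<in>insert e S. g ((\<lambda>i. if i \<in> insert e S then t else q i)(e' := 1))
           - g ((\<lambda>i. if i \<in> insert e S then t else q i)(e' := 0)))"
  proof -
    have "g ((\<lambda>i. if i \<in> insert e S then t else q i)(e' := v))
        = t * g ((?d (q(e := 1)))(e' := v)) + (1 - t) * g ((?d (q(e := 0)))(e' := v))"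
      if e': "e' \<in> S" and v: "v \<in> {0..1}" for e' v
    proof -
      have ne: "e' \<noteq> e" using e' insert.hyps by auto
      have 1: "(\<lambda>i. if i \<in> insert e S then t else q i)(e' := v) = ((?d q)(e' := v))(e := t)"
        using ne by (simp add: fun_eq_iff)
      have 2: "(?d (q(e := u)))(e' := v) = ((?d q)(e' := v))(e := u)" for u
        using ne insert.hyps(2) by (auto simp: fun_eq_iff)
      show ?thesis unfolding 1 2
        using t v insert.prems(2) by (intro insert.prems(1)) (simp_all del: atLeastAtMost_iff)
    qed
    then have "(\<Sum>e'\<in>S. g ((\<lambda>i. if i \<in> insert e S then t else q i)(e' := 1))
           - g ((\<lambda>i. if i \<in> insert e S then t else q i)(e' := 0)))
       = (\<Sum>e'\<in>S. t * (g ((?d (q(e := 1)))(e' := 1)) - g ((?d (q(e := 1)))(e' := 0)))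
          + (1 - t) * (g ((?d (q(e := 0)))(e' := 1)) - g ((?d (q(e := 0)))(e' := 0))))"
      by (intro sum.cong refl) (simp add: algebra_simps)
    also have "\<dots> = ?D (q(e := 1)) * t + ?D (q(e := 0)) * (1 - t)"
      by (simp add: sum.distrib sum_distrib_left[symmetric] mult.commute)
    moreover have "(\<lambda>i. if i \<in> insert e S then t else q i)(e := v) = ?d (q(e := v))" for v
      using insert.hyps(2) by (auto simp: fun_eq_iff)
    ultimately show ?thesis by (simp add: insert.hyps(1,2))
  qed
  finally show ?case
    by (rule has_field_derivative_transform_within[of _ _ _ _ 1]) (use split t in auto)
qed

section \<open>Edge sums and overlaps\<close>

lemma sum_site_pairs_products:
  "2 * (\<Sum>e\<in>site_pairs N. x (fst e) * x (snd e)) = (\<Sum>i\<in>{1..N}. x i)\<^sup>2 - (\<Sum>i\<in>{1..N}. (x i)\<^sup>2)"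
  for x :: "nat \<Rightarrow> real"
proof (induction N)
  case 0
  have "site_pairs 0 = {}" by (auto simp: site_pairs_def)
  then show ?case by simp
next
  case (Suc N)
  have I: "site_pairs (Suc N) = site_pairs N \<union> (\<lambda>i. (i, Suc N)) ` {1..N}"
    by (auto simp: site_pairs_def le_Suc_eq)
  have "(\<Sum>e\<in>site_pairs (Suc N). x (fst e) * x (snd e))
      = (\<Sum>e\<in>site_pairs N. x (fst e) * x (snd e)) + (\<Sum>e\<in>(\<lambda>i. (i, Suc N)) ` {1..N}. x (fst e) * x (snd e))"
    unfolding I by (intro sum.union_disjoint finite_site_pairs) (auto simp: site_pairs_def)
  also have "(\<Sum>e\<in>(\<lambda>i. (i, Suc N)) ` {1..N}. x (fst e) * x (snd e)) = (\<Sum>i\<in>{1..N}. x i) * x (Suc N)"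
    by (subst sum.reindex) (auto simp: inj_on_def sum_distrib_right)
  finally show ?case using Suc by (simp add: power2_sum)
qed

text \<open>
  The product of two independent replicas turns \<open>\<langle>\<sigma>\<^sub>i \<sigma>\<^sub>j\<rangle>\<^sup>2\<close> into an average of \<open>R\<^sub>1\<^sub>2\<^sup>2\<close>.
\<close>

lemma overlap_square_bracket:
  assumes "N \<ge> 1"
  shows "(real N)\<^sup>2 * gibbs_bracket N 2 J (\<lambda>\<sigma>. (overlap N 1 2 \<sigma>)\<^sup>2)
       = (\<Sum>i\<in>{1..N}. \<Sum>j\<in>{1..N}. (gibbs_mean N J (\<lambda>\<tau>. \<tau> i * \<tau> j))\<^sup>2)"
proof -
  have "(real N)\<^sup>2 * (overlap N 1 2 \<sigma>)\<^sup>2 = (\<Sum>i\<in>{1..N}. \<Sum>j\<in>{1..N}. \<Prod>l\<in>{1..2}. \<sigma> l i * \<sigma> l j)" for \<sigma>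
  proof -
    have "(real N)\<^sup>2 * (overlap N 1 2 \<sigma>)\<^sup>2 = (\<Sum>i\<in>{1..N}. \<sigma> 1 i * \<sigma> 2 i)\<^sup>2"
      using assms by (simp add: overlap_def power_mult_distrib power_divide)
    also have "\<dots> = (\<Sum>i\<in>{1..N}. \<Sum>j\<in>{1..N}. (\<sigma> 1 i * \<sigma> 2 i) * (\<sigma> 1 j * \<sigma> 2 j))"
      unfolding power2_eq_square sum_product ..
    also have "\<dots> = (\<Sum>i\<in>{1..N}. \<Sum>j\<in>{1..N}. \<Prod>l\<in>{1..2}. \<sigma> l i * \<sigma> l j)"
      by (intro sum.cong refl) (simp add: numeral_2_eq_2 mult_ac)
    finally show ?thesis .
  qed
  then have "(real N)\<^sup>2 * gibbs_bracket N 2 J (\<lambda>\<sigma>. (overlap N 1 2 \<sigma>)\<^sup>2)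
     = (\<Sum>i\<in>{1..N}. \<Sum>j\<in>{1..N}. gibbs_bracket N 2 J (\<lambda>\<sigma>. \<Prod>l\<in>{1..2}. \<sigma> l i * \<sigma> l j))"
    unfolding gibbs_bracket_cmult[symmetric] gibbs_bracket_sum[symmetric] by simp
  also have "\<dots> = (\<Sum>i\<in>{1..N}. \<Sum>j\<in>{1..N}. (gibbs_mean N J (\<lambda>\<tau>. \<tau> i * \<tau> j))\<^sup>2)"
    by (intro sum.cong refl, subst gibbs_bracket_prod[of _ 2 N J "\<lambda>\<tau>. \<tau> i * \<tau> j" for i j]) auto
  finally show ?thesis .
qed

text \<open>
  With \<open>x\<^sub>i = \<Prod>\<^bsub>l\<in>T\<^esub> \<sigma>\<^sub>i\<^sup>l\<close> the sum over the edges is \<open>((\<Sum>\<^sub>i x\<^sub>i)\<^sup>2 - N) / 2\<close>, and the mean of the square is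
  \<open>\<Sum>\<^bsub>i,j\<^esub> \<langle>\<sigma>\<^sub>i \<sigma>\<^sub>j\<rangle>^card T\<close>.  As \<open>card T\<close> is even and positive, these powers are at most the squares, which
  make up the mean of \<open>R\<^sub>1\<^sub>2\<^sup>2\<close>.  The same Gibbs measure must appear for all edges.
\<close>

lemma edge_sum_bracket_le:
  assumes N: "N \<ge> 1" and T: "T \<subseteq> {1..r}" "even (card T)" "T \<noteq> {}"
    and A: "\<And>\<sigma>. \<sigma> \<in> replica_configs N r \<Longrightarrow> \<bar>A \<sigma>\<bar> \<le> c"
  shows "\<bar>\<Sum>e\<in>site_pairs N. gibbs_bracket N r J (\<lambda>\<sigma>. A \<sigma> * (\<Prod>l\<in>T. edge_spin e (\<sigma> l)))\<bar>
     \<le> c / 2 * ((real N)\<^sup>2 * gibbs_bracket N 2 J (\<lambda>\<sigma>. (overlap N 1 2 \<sigma>)\<^sup>2) + real N)"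
proof -
  let ?x = "\<lambda>\<sigma> i. \<Prod>l\<in>T. \<sigma> l i :: real"
  have c: "0 \<le> c"
  proof -
    obtain \<sigma> where "\<sigma> \<in> replica_configs N r" using replica_configs_nonempty by blast
    from A[OF this] show ?thesis by linarith
  qed
  have finT: "finite T" using T(1) finite_subset by auto
  have "card T \<noteq> 0" using finT T(3) by simp
  then have card: "2 \<le> card T" using T(2) by presburger
  have "\<bar>\<Sum>e\<in>site_pairs N. gibbs_bracket N r J (\<lambda>\<sigma>. A \<sigma> * (\<Prod>l\<in>T. edge_spin e (\<sigma> l)))\<bar>
      = \<bar>gibbs_bracket N r J (\<lambda>\<sigma>. A \<sigma> * (\<Sum>e\<in>site_pairs N. ?x \<sigma> (fst e) * ?x \<sigma> (snd e)))\<bar>"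
    unfolding gibbs_bracket_sum[symmetric]
    by (simp add: sum_distrib_left edge_spin_def prod.distrib)
  also have "\<dots> \<le> gibbs_bracket N r J (\<lambda>\<sigma>. c / 2 * ((\<Sum>i\<in>{1..N}. ?x \<sigma> i)\<^sup>2 + real N))"
  proof (rule gibbs_bracket_abs_le)
    fix \<sigma> assume \<sigma>: "\<sigma> \<in> replica_configs N r"
    have "(?x \<sigma> i)\<^sup>2 = 1" if "i \<in> {1..N}" for i
    proof -
      have "(?x \<sigma> i)\<^sup>2 = (\<Prod>l\<in>T. (\<sigma> l i)\<^sup>2)" by (simp add: prod_power_distrib)
      also have "\<dots> = (\<Prod>l\<in>T. 1)"
      proof (rule prod.cong[OF refl])
        fix l assume "l \<in> T"
        then have "\<sigma> l \<in> spin_configs N" using T(1) replica_component[OF \<sigma>] by auto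
        from spin_values[OF this that] show "(\<sigma> l i)\<^sup>2 = 1" by auto
      qed
      finally show ?thesis by simp
    qed
    then have s: "2 * (\<Sum>e\<in>site_pairs N. ?x \<sigma> (fst e) * ?x \<sigma> (snd e)) = (\<Sum>i\<in>{1..N}. ?x \<sigma> i)\<^sup>2 - real N"
      unfolding sum_site_pairs_products[of "?x \<sigma>"] by simp
    define X where "X = (\<Sum>i\<in>{1..N}. ?x \<sigma> i)\<^sup>2"
    define Y where "Y = (\<Sum>e\<in>site_pairs N. ?x \<sigma> (fst e) * ?x \<sigma> (snd e))"
    have "0 \<le> X" by (simp add: X_def)
    moreover have "2 * Y = X - real N" using s by (simp add: X_def Y_def)
    ultimately have "\<bar>Y\<bar> \<le> (X + real N) / 2" by (simp add: abs_le_iff)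
    then have "\<bar>A \<sigma>\<bar> * \<bar>Y\<bar> \<le> c * ((X + real N) / 2)" using A[OF \<sigma>] c by (intro mult_mono) auto
    then show "\<bar>A \<sigma> * Y\<bar> \<le> c / 2 * (X + real N)" by (simp add: abs_mult)
  qed
  also have "\<dots> = c / 2 * (gibbs_bracket N r J (\<lambda>\<sigma>. (\<Sum>i\<in>{1..N}. ?x \<sigma> i)\<^sup>2) + real N)"
  proof -
    have "gibbs_bracket N r J (\<lambda>\<sigma>. (\<Sum>i\<in>{1..N}. ?x \<sigma> i)\<^sup>2 + real N)
        = gibbs_bracket N r J (\<lambda>\<sigma>. (\<Sum>i\<in>{1..N}. ?x \<sigma> i)\<^sup>2) + gibbs_bracket N r J (\<lambda>_. real N)"
      unfolding gibbs_bracket_def by (simp add: distrib_right sum.distrib)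
    then show ?thesis unfolding gibbs_bracket_cmult gibbs_bracket_const by simp
  qed
  also have "gibbs_bracket N r J (\<lambda>\<sigma>. (\<Sum>i\<in>{1..N}. ?x \<sigma> i)\<^sup>2)
      = (\<Sum>i\<in>{1..N}. \<Sum>j\<in>{1..N}. gibbs_mean N J (\<lambda>\<tau>. \<tau> i * \<tau> j) ^ card T)"
  proof -
    have "(\<Sum>i\<in>{1..N}. ?x \<sigma> i)\<^sup>2 = (\<Sum>i\<in>{1..N}. \<Sum>j\<in>{1..N}. \<Prod>l\<in>T. \<sigma> l i * \<sigma> l j)" for \<sigma>
      unfolding power2_eq_square sum_product prod.distrib ..
    then have "gibbs_bracket N r J (\<lambda>\<sigma>. (\<Sum>i\<in>{1..N}. ?x \<sigma> i)\<^sup>2)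
        = (\<Sum>i\<in>{1..N}. \<Sum>j\<in>{1..N}. gibbs_bracket N r J (\<lambda>\<sigma>. \<Prod>l\<in>T. \<sigma> l i * \<sigma> l j))"
      by (simp only: gibbs_bracket_sum)
    then show ?thesis
      unfolding gibbs_bracket_prod[OF T(1), of N J "\<lambda>\<tau>. \<tau> i * \<tau> j" for i j] .
  qed
  also have "\<dots> \<le> (\<Sum>i\<in>{1..N}. \<Sum>j\<in>{1..N}. (gibbs_mean N J (\<lambda>\<tau>. \<tau> i * \<tau> j))\<^sup>2)"
  proof (intro sum_mono)
    fix i j assume ij: "i \<in> {1..N}" "j \<in> {1..N}"
    let ?m = "gibbs_mean N J (\<lambda>\<tau>. \<tau> i * \<tau> j)"
    have "\<bar>?m\<bar> \<le> 1"
    proof (rule gibbs_mean_abs_le)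
      fix \<tau> assume "\<tau> \<in> spin_configs N"
      from spin_values[OF this ij(1)] spin_values[OF this ij(2)] show "\<bar>\<tau> i * \<tau> j\<bar> \<le> 1" by auto
    qed
    then have "\<bar>?m\<bar> ^ card T \<le> \<bar>?m\<bar> ^ 2" using card by (intro power_decreasing) auto
    then show "?m ^ card T \<le> ?m\<^sup>2" using T(2) by (simp add: power_even_abs)
  qed
  also note overlap_square_bracket[OF N, of J, symmetric]
  finally show ?thesis using c by (simp add: mult_left_mono)
qed

section \<open>Interpolation between two laws\<close>

lemma restrict_replica_config: "\<sigma> \<in> replica_configs N (r + j) \<Longrightarrow> restrict \<sigma> {1..r} \<in> replica_configs N r"
  unfolding replica_configs_def by (auto simp: PiE_def Pi_def)

lemma edge_correlation_as_bracket:
  assumes S: "S \<subseteq> {1..r}"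
  shows "edge_correlation N r e J A S j = gibbs_bracket N (r + j) J
    (\<lambda>\<sigma>. A (restrict \<sigma> {1..r}) * (\<Prod>l\<in>S \<union> {r<..r + j}. edge_spin e (\<sigma> l)))"
proof -
  have fin: "finite S" using S finite_subset by auto
  have "(\<Prod>l\<in>S \<union> {r<..r + j}. edge_spin e (\<sigma> l))
      = (\<Prod>l\<in>S. edge_spin e (restrict \<sigma> {1..r} l)) * (\<Prod>l\<in>{r<..r + j}. edge_spin e (\<sigma> l))" for \<sigma>
  proof -
    have "(\<Prod>l\<in>S \<union> {r<..r + j}. edge_spin e (\<sigma> l))
        = (\<Prod>l\<in>S. edge_spin e (\<sigma> l)) * (\<Prod>l\<in>{r<..r + j}. edge_spin e (\<sigma> l))"
      using S fin by (intro prod.union_disjoint) auto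
    also have "(\<Prod>l\<in>S. edge_spin e (\<sigma> l)) = (\<Prod>l\<in>S. edge_spin e (restrict \<sigma> {1..r} l))"
      using S by (intro prod.cong refl) (simp add: subset_iff)
    finally show ?thesis .
  qed
  then show ?thesis
    unfolding edge_correlation_def
    using gibbs_bracket_fresh_replicas[of N r j J "\<lambda>\<sigma>. A \<sigma> * (\<Prod>l\<in>S. edge_spin e (\<sigma> l))" "edge_spin e"]
    by (simp only: mult.assoc)
qed

definition cavity_const :: "nat \<Rightarrow> real \<Rightarrow> real" where
  "cavity_const r K = expansion_mass r + 720 * remainder_const r * K"

lemma cavity_const_nonneg: "0 \<le> K \<Longrightarrow> 0 \<le> cavity_const r K"
  by (simp add: cavity_const_def expansion_mass_nonneg remainder_const_nonneg)

lemma prob_integral_abs_le: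
  fixes h :: "'a \<Rightarrow> real"
  assumes "prob_space P" "integrable P h" "\<And>x. \<bar>h x\<bar> \<le> c"
  shows "\<bar>LINT x|P. h x\<bar> \<le> c"
proof -
  interpret prob_space P by fact
  have "\<bar>LINT x|P. h x\<bar> \<le> (LINT x|P. \<bar>h x\<bar>)" by (rule integral_abs_bound)
  also have "\<dots> \<le> (LINT x|P. c)" using assms by (intro integral_mono) auto
  finally show ?thesis by (simp add: prob_space)
qed

text \<open>
  The terms at different edges involve different Gibbs measures, each with its own coupling set to
  \<open>0\<close>.  By \<open>edge_average_cavity\<close>, redrawing that coupling from \<open>\<mu>\<close> changes a term by \<open>O(1/N)\<close>, and by
  \<open>hybrid_average_resample\<close> the redrawn couplings have the original joint law, so that
  \<open>edge_sum_bracket_le\<close> applies.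
\<close>

lemma summed_edge_correlation_le:
  assumes g: "good_law a K \<mu>" and a: "2 * real (r + j) + 1 \<le> a" and N: "N \<ge> 1"
    and S: "S \<subseteq> {1..r}" and even: "even (card S + j)" "card S + j \<noteq> 0"
  shows "\<bar>\<Sum>e\<in>site_pairs N. LINT J|Pi\<^sub>M (site_pairs N) (\<lambda>_. \<mu>). edge_correlation N r e (J(e := 0)) A S j\<bar>
     \<le> (real N)\<^sup>2 * ((1 + cavity_const (r + j) K) * sup_norm N r A
          * (disorder_average \<mu> N 2 (\<lambda>\<sigma>. (overlap N 1 2 \<sigma>)\<^sup>2) + 1 / real N))"
proof -
  let ?P = "Pi\<^sub>M (site_pairs N) (\<lambda>_. \<mu>)" and ?r = "r + j" and ?T = "S \<union> {r<..r + j}"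
  let ?A = "\<lambda>\<sigma>. A (restrict \<sigma> {1..r})" and ?n = "sup_norm N r A"
  let ?B = "\<lambda>e \<sigma>. ?A \<sigma> * (\<Prod>l\<in>?T. edge_spin e (\<sigma> l))"
  define \<rho> where "\<rho> = disorder_average \<mu> N 2 (\<lambda>\<sigma>. (overlap N 1 2 \<sigma>)\<^sup>2)"
  define k where "k = cavity_const ?r K"
  have K: "0 \<le> K" using good_law_K_ge_1[OF g] a by simp
  have k: "0 \<le> k" unfolding k_def by (rule cavity_const_nonneg[OF K])
  have n: "0 \<le> ?n" by (rule sup_norm_nonneg)
  have \<rho>: "0 \<le> \<rho>" unfolding \<rho>_def hybrid_average_const[symmetric] by (rule hybrid_average_nonneg) simp
  have P: "prob_space ?P" by (intro prob_space_PiM good_law_prob[OF g])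
  have T: "?T \<subseteq> {1..?r}" using S by auto
  have cardT: "card ?T = card S + j"
    using S finite_subset[OF S] by (subst card_Un_disjoint) auto
  have A: "\<bar>?A \<sigma>\<bar> \<le> ?n" if "\<sigma> \<in> replica_configs N ?r" for \<sigma>
    by (rule abs_le_sup_norm[OF restrict_replica_config[OF that]])
  have cavity: "\<bar>(LINT J|?P. gibbs_bracket N ?r (J(e := 0)) (?B e)) - (LINT J|?P. gibbs_bracket N ?r J (?B e))\<bar>
      \<le> k / real N * ?n" if e: "e \<in> site_pairs N" for e
  proof -
    have "sup_norm N ?r (?B e) \<le> ?n"
      unfolding sup_norm_def[of N ?r]
      using A by (subst Max_le_iff) (auto simp: abs_mult abs_edge_prod[OF e _ T] simp del: prod.union_disjoint)
    then have c: "k / real N * sup_norm N ?r (?B e) \<le> k / real N * ?n"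
      using k by (intro mult_left_mono) auto
    have i: "integrable ?P (edge_average \<mu> N ?r e (?B e))"
      "integrable ?P (\<lambda>J. gibbs_bracket N ?r (J(e := 0)) (?B e))"
      by (rule integrable_edge_average[OF g e g], rule integrable_gibbs_bracket_cavity[OF g])
    have "(LINT J|?P. gibbs_bracket N ?r J (?B e)) = hybrid_average ((\<lambda>_. \<mu>)(e := \<mu>)) N ?r (?B e)"
      by (simp add: hybrid_average_def)
    also have "\<dots> = (LINT J|?P. edge_average \<mu> N ?r e (?B e) J)"
      by (rule hybrid_average_resample[OF g e g])
    finally have "(LINT J|?P. gibbs_bracket N ?r J (?B e)) - (LINT J|?P. gibbs_bracket N ?r (J(e := 0)) (?B e))
       = (LINT J|?P. edge_average \<mu> N ?r e (?B e) J - gibbs_bracket N ?r (J(e := 0)) (?B e))"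
      using i by simp
    also have "\<bar>\<dots>\<bar> \<le> k / real N * ?n"
    proof (rule prob_integral_abs_le[OF P])
      show "\<bar>edge_average \<mu> N ?r e (?B e) J - gibbs_bracket N ?r (J(e := 0)) (?B e)\<bar> \<le> k / real N * ?n" for J
        using edge_average_cavity[OF g a e N, of "?B e" J] c unfolding k_def cavity_const_def by linarith
    qed (use i in auto)
    finally show ?thesis by (simp add: abs_minus_commute)
  qed
  have swap: "(\<Sum>e\<in>site_pairs N. LINT J|?P. gibbs_bracket N ?r J (?B e))
      = (LINT J|?P. (\<Sum>e\<in>site_pairs N. gibbs_bracket N ?r J (?B e)))"
    by (rule Bochner_Integration.integral_sum[symmetric]) (rule integrable_gibbs_bracket[OF g])
  have "\<bar>\<Sum>e\<in>site_pairs N. LINT J|?P. gibbs_bracket N ?r J (?B e)\<bar>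
      \<le> (LINT J|?P. \<bar>\<Sum>e\<in>site_pairs N. gibbs_bracket N ?r J (?B e)\<bar>)"
    unfolding swap by (rule integral_abs_bound)
  also have "\<dots> \<le> (LINT J|?P. ?n / 2 * ((real N)\<^sup>2 * gibbs_bracket N 2 J (\<lambda>\<sigma>. (overlap N 1 2 \<sigma>)\<^sup>2) + real N))"
  proof (intro integral_mono)
    have ev: "even (card ?T)" using even(1) unfolding cardT .
    have "card ?T \<noteq> 0" using even(2) unfolding cardT .
    then have ne: "?T \<noteq> {}" by (rule contrapos_nn) (simp only: card.empty)
    show "\<bar>\<Sum>e\<in>site_pairs N. gibbs_bracket N ?r J (?B e)\<bar>
      \<le> ?n / 2 * ((real N)\<^sup>2 * gibbs_bracket N 2 J (\<lambda>\<sigma>. (overlap N 1 2 \<sigma>)\<^sup>2) + real N)" for J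
      by (rule edge_sum_bracket_le[OF N T ev ne, where A = ?A and c = ?n]) (rule A)
    interpret P: prob_space ?P by (rule P)
    show "integrable ?P (\<lambda>J. ?n / 2 * ((real N)\<^sup>2 * gibbs_bracket N 2 J (\<lambda>\<sigma>. (overlap N 1 2 \<sigma>)\<^sup>2) + real N))"
      by (intro integrable_mult_right Bochner_Integration.integrable_add integrable_gibbs_bracket[OF g]) simp
  qed (intro integrable_abs Bochner_Integration.integrable_sum integrable_gibbs_bracket[OF g])
  also have "\<dots> = ?n / 2 * ((real N)\<^sup>2 * \<rho> + real N)"
  proof -
    interpret P: prob_space ?P by (rule P)
    have "integrable ?P (\<lambda>J. gibbs_bracket N 2 J (\<lambda>\<sigma>. (overlap N 1 2 \<sigma>)\<^sup>2))"
      by (rule integrable_gibbs_bracket[OF g])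
    then show ?thesis by (simp add: \<rho>_def disorder_average_def P.prob_space del: One_nat_def)
  qed
  finally have full: "\<bar>\<Sum>e\<in>site_pairs N. LINT J|?P. gibbs_bracket N ?r J (?B e)\<bar> \<le> ?n / 2 * ((real N)\<^sup>2 * \<rho> + real N)" .
  have "\<bar>(\<Sum>e\<in>site_pairs N. LINT J|?P. gibbs_bracket N ?r (J(e := 0)) (?B e))
       - (\<Sum>e\<in>site_pairs N. LINT J|?P. gibbs_bracket N ?r J (?B e))\<bar>
      \<le> (\<Sum>e\<in>site_pairs N. k / real N * ?n)"
    unfolding sum_subtractf[symmetric] by (intro order_trans[OF sum_abs] sum_mono cavity)
  also have "\<dots> = real (card (site_pairs N)) * (k / real N * ?n)" by simp
  also have "\<dots> \<le> real (N\<^sup>2) * (k / real N * ?n)"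
    using card_site_pairs_le k n by (intro mult_right_mono) (simp_all only: of_nat_le_iff, simp)
  also have "\<dots> = (real N)\<^sup>2 * (k * ?n * (1 / real N))" by simp
  finally have "\<bar>\<Sum>e\<in>site_pairs N. LINT J|?P. gibbs_bracket N ?r (J(e := 0)) (?B e)\<bar>
      \<le> ?n / 2 * ((real N)\<^sup>2 * \<rho> + real N) + (real N)\<^sup>2 * (k * ?n * (1 / real N))"
    using full by linarith
  also have "?n / 2 * ((real N)\<^sup>2 * \<rho> + real N) = (real N)\<^sup>2 * (1 / 2 * ?n * (\<rho> + 1 / real N))"
    using N by (simp add: power2_eq_square field_simps)
  also have "\<dots> + (real N)\<^sup>2 * (k * ?n * (1 / real N))
      \<le> (real N)\<^sup>2 * (1 * ?n * (\<rho> + 1 / real N)) + (real N)\<^sup>2 * (k * ?n * (\<rho> + 1 / real N))"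
    using n k \<rho> by (intro add_mono mult_left_mono mult_right_mono mult_nonneg_nonneg) auto
  also have "\<dots> = (real N)\<^sup>2 * ((1 + k) * ?n * (\<rho> + 1 / real N))" by (simp add: algebra_simps)
  finally show ?thesis unfolding edge_correlation_as_bracket[OF S] k_def \<rho>_def .
qed

text \<open>
  The sum over \<open>j\<close> dominates \<open>cavity_const (r + j) K\<close> for each number \<open>j\<close> of replicas added in the
  expansion.
\<close>

definition drift_const :: "nat \<Rightarrow> real \<Rightarrow> real" where
  "drift_const r K = 48 * K * expansion_mass r * (1 + (\<Sum>j\<le>5 * r. cavity_const (r + j) K))
     + 1440 * remainder_const r * K"

text \<open>
  In the difference of the two expansions, terms of degree \<open>0\<close> or of odd degree vanish, and every
  other one is \<open>O(N^-2)\<close> times an edge sum controlled by \<open>summed_edge_correlation_le\<close>.  The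
  remainders are \<open>O(N^-3)\<close> each, hence \<open>O(1/N)\<close> together.  The order \<open>12 r + 1\<close> of the exponential moment
  accounts for the at most \<open>r + 5 r\<close> replicas of these terms.
\<close>

lemma interpolation_drift_le:
  assumes g: "good_law a K \<nu>" "good_law a K \<gamma>" "good_law a K \<mu>" and a: "12 * real r + 1 \<le> a" and N: "N \<ge> 1"
  shows "\<bar>\<Sum>e\<in>site_pairs N. (LINT J|Pi\<^sub>M (site_pairs N) (\<lambda>_. \<mu>). edge_average \<nu> N r e A J)
             - (LINT J|Pi\<^sub>M (site_pairs N) (\<lambda>_. \<mu>). edge_average \<gamma> N r e A J)\<bar>
     \<le> drift_const r K * sup_norm N r A * (disorder_average \<mu> N 2 (\<lambda>\<sigma>. (overlap N 1 2 \<sigma>)\<^sup>2) + 1 / real N)"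
proof -
  let ?P = "Pi\<^sub>M (site_pairs N) (\<lambda>_. \<mu>)" and ?n = "sup_norm N r A" and ?c = "coeff (geom6 ^ r)"
  let ?E = "\<lambda>e J S j. edge_correlation N r e (J(e := 0)) A S j"
  let ?d = "\<lambda>k. tanh_moment N \<nu> k - tanh_moment N \<gamma> k"
  define R where "R = disorder_average \<mu> N 2 (\<lambda>\<sigma>. (overlap N 1 2 \<sigma>)\<^sup>2) + 1 / real N"
  define k where "k = (\<Sum>j\<le>5 * r. cavity_const (r + j) K)"
  define \<epsilon> where "\<epsilon> = 1440 * remainder_const r * K / real N ^ 3 * ?n"
  have a': "2 * real r + 1 \<le> a" using a by simp
  have K: "0 \<le> K" using good_law_K_ge_1[OF g(1)] a by simp
  have n: "0 \<le> ?n" by (rule sup_norm_nonneg)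
  have "0 \<le> disorder_average \<mu> N 2 (\<lambda>\<sigma>. (overlap N 1 2 \<sigma>)\<^sup>2)"
    unfolding hybrid_average_const[symmetric] by (rule hybrid_average_nonneg) simp
  then have R: "1 / real N \<le> R" "0 \<le> R" unfolding R_def by auto
  have kj: "cavity_const (r + j) K \<le> k" if "j \<le> 5 * r" for j
    unfolding k_def by (rule member_le_sum[of j]) (use that cavity_const_nonneg[OF K] in auto)
  have P: "prob_space ?P" by (intro prob_space_PiM good_law_prob[OF g(3)])
  have iE: "integrable ?P (\<lambda>J. ?E e J S j)" if "S \<subseteq> {1..r}" for e S j
    unfolding edge_correlation_as_bracket[OF that] by (rule integrable_gibbs_bracket_cavity[OF g(3)])
  let ?main = "\<lambda>e J. \<Sum>S\<in>Pow {1..r}. \<Sum>j\<le>5 * r. ?c j * (?d (card S + j) * ?E e J S j)"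
  have i_main: "integrable ?P (?main e)" for e
    by (intro Bochner_Integration.integrable_sum integrable_mult_right iE) auto
  have one: "\<bar>(LINT J|?P. edge_average \<nu> N r e A J) - (LINT J|?P. edge_average \<gamma> N r e A J) - (LINT J|?P. ?main e J)\<bar> \<le> \<epsilon>"
    if e: "e \<in> site_pairs N" for e
  proof -
    note i = integrable_edge_average[OF g(3) e g(1), of r A] integrable_edge_average[OF g(3) e g(2), of r A]
    have "\<bar>edge_average \<nu> N r e A J - edge_average \<gamma> N r e A J - ?main e J\<bar> \<le> \<epsilon>" for J
    proof -
      define a0 where "a0 = gibbs_bracket N r (J(e := 0)) (\<lambda>\<sigma>. \<bar>A \<sigma>\<bar>)"
      have "a0 \<le> ?n"
        using gibbs_bracket_abs_le_const[of N r "\<lambda>\<sigma>. \<bar>A \<sigma>\<bar>" ?n "J(e := 0)"]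
        unfolding a0_def by (simp add: abs_le_sup_norm)
      then have "720 * remainder_const r * K / real N ^ 3 * a0 \<le> 720 * remainder_const r * K / real N ^ 3 * ?n"
        using K by (intro mult_left_mono) (auto simp: remainder_const_nonneg)
      moreover have "?main e J
         = (\<Sum>S\<in>Pow {1..r}. \<Sum>j\<le>5 * r. ?c j * tanh_moment N \<nu> (card S + j) * ?E e J S j)
         - (\<Sum>S\<in>Pow {1..r}. \<Sum>j\<le>5 * r. ?c j * tanh_moment N \<gamma> (card S + j) * ?E e J S j)"
        by (simp add: sum_subtractf[symmetric] algebra_simps)
      ultimately show ?thesis
        using edge_average_expansion[OF g(1) a' e N, of A J] edge_average_expansion[OF g(2) a' e N, of A J]
        unfolding \<epsilon>_def a0_def by linarith
    qed
    then have "\<bar>LINT J|?P. edge_average \<nu> N r e A J - edge_average \<gamma> N r e A J - ?main e J\<bar> \<le> \<epsilon>"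
      using i i_main by (intro prob_integral_abs_le[OF P]) auto
    then show ?thesis using i i_main by simp
  qed
  have "(\<Sum>e\<in>site_pairs N. LINT J|?P. ?main e J)
     = (\<Sum>S\<in>Pow {1..r}. \<Sum>j\<le>5 * r. ?c j * (?d (card S + j) * (\<Sum>e\<in>site_pairs N. LINT J|?P. ?E e J S j)))"
  proof -
    have "(LINT J|?P. ?main e J) = (\<Sum>S\<in>Pow {1..r}. \<Sum>j\<le>5 * r. ?c j * (?d (card S + j) * (LINT J|?P. ?E e J S j)))" for e
    proof -
      have "(LINT J|?P. ?main e J) = (\<Sum>S\<in>Pow {1..r}. LINT J|?P. (\<Sum>j\<le>5 * r. ?c j * (?d (card S + j) * ?E e J S j)))"
        by (intro Bochner_Integration.integral_sum Bochner_Integration.integrable_sum integrable_mult_right iE) auto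
      also have "\<dots> = (\<Sum>S\<in>Pow {1..r}. \<Sum>j\<le>5 * r. LINT J|?P. ?c j * (?d (card S + j) * ?E e J S j))"
        by (intro sum.cong refl Bochner_Integration.integral_sum integrable_mult_right iE) auto
      finally show ?thesis by simp
    qed
    then have "(\<Sum>e\<in>site_pairs N. LINT J|?P. ?main e J)
      = (\<Sum>e\<in>site_pairs N. \<Sum>S\<in>Pow {1..r}. \<Sum>j\<le>5 * r. ?c j * (?d (card S + j) * (LINT J|?P. ?E e J S j)))"
      by simp
    also have "\<dots> = (\<Sum>S\<in>Pow {1..r}. \<Sum>e\<in>site_pairs N. \<Sum>j\<le>5 * r. ?c j * (?d (card S + j) * (LINT J|?P. ?E e J S j)))"
      by (rule sum.swap)
    also have "\<dots> = (\<Sum>S\<in>Pow {1..r}. \<Sum>j\<le>5 * r. \<Sum>e\<in>site_pairs N. ?c j * (?d (card S + j) * (LINT J|?P. ?E e J S j)))"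
      by (intro sum.cong refl sum.swap)
    finally show ?thesis by (simp add: sum_distrib_left)
  qed
  moreover have "\<bar>\<dots>\<bar> \<le> expansion_mass r * (48 * K * ((1 + k) * ?n * R))"
  proof (rule weighted_expansion_le)
    fix S j assume S: "S \<subseteq> {1..r}" and j: "j \<le> 5 * r"
    let ?s = "\<Sum>e\<in>site_pairs N. LINT J|?P. ?E e J S j"
    have k0: "0 \<le> k" using kj[of 0] cavity_const_nonneg[OF K, of "r + 0"] by simp
    show "\<bar>?d (card S + j) * ?s\<bar> \<le> 48 * K * ((1 + k) * ?n * R)"
    proof (cases "odd (card S + j) \<or> card S + j = 0")
      case True
      then have "?d (card S + j) = 0"
        using tanh_moment_odd[OF g(1)] tanh_moment_odd[OF g(2)] tanh_moment_0[OF g(1)] tanh_moment_0[OF g(2)]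
        by (metis diff_self)
      then show ?thesis using K n R k0 by simp
    next
      case False
      have "\<bar>?s\<bar> \<le> (real N)\<^sup>2 * ((1 + cavity_const (r + j) K) * ?n * R)"
        unfolding R_def by (rule summed_edge_correlation_le[OF g(3) _ N S]) (use False a j in auto)
      also have "\<dots> \<le> (real N)\<^sup>2 * ((1 + k) * ?n * R)"
        using kj[OF j] n R by (intro mult_left_mono mult_right_mono) auto
      finally have s: "\<bar>?s\<bar> \<le> (real N)\<^sup>2 * ((1 + k) * ?n * R)" .
      have "\<bar>?d (card S + j)\<bar> \<le> 48 * K / (real N)\<^sup>2"
        using a by (intro tanh_moment_diff_le[OF g(1,2)]) simp
      then have "\<bar>?d (card S + j)\<bar> * \<bar>?s\<bar> \<le> 48 * K / (real N)\<^sup>2 * ((real N)\<^sup>2 * ((1 + k) * ?n * R))"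
        using s K by (intro mult_mono) auto
      also have "\<dots> = 48 * K * ((1 + k) * ?n * R)" using N by simp
      finally show ?thesis by (simp only: abs_mult)
    qed
  qed
  moreover have "\<bar>(\<Sum>e\<in>site_pairs N. (LINT J|?P. edge_average \<nu> N r e A J) - (LINT J|?P. edge_average \<gamma> N r e A J))
       - (\<Sum>e\<in>site_pairs N. LINT J|?P. ?main e J)\<bar> \<le> 1440 * remainder_const r * K * ?n * R"
  proof -
    have "\<bar>(\<Sum>e\<in>site_pairs N. (LINT J|?P. edge_average \<nu> N r e A J) - (LINT J|?P. edge_average \<gamma> N r e A J))
       - (\<Sum>e\<in>site_pairs N. LINT J|?P. ?main e J)\<bar> \<le> (\<Sum>e\<in>site_pairs N. \<epsilon>)"
      unfolding sum_subtractf[symmetric] by (intro order_trans[OF sum_abs] sum_mono one)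
    also have "\<dots> = real (card (site_pairs N)) * \<epsilon>" by simp
    also have "\<dots> \<le> real (N\<^sup>2) * \<epsilon>"
      using card_site_pairs_le K n remainder_const_nonneg
      by (intro mult_right_mono) (simp_all only: of_nat_le_iff, simp add: \<epsilon>_def)
    also have "\<dots> = 1440 * remainder_const r * K * ?n * (1 / real N)"
      using N by (simp add: \<epsilon>_def power2_eq_square power3_eq_cube)
    also have "\<dots> \<le> 1440 * remainder_const r * K * ?n * R"
      using K n R by (intro mult_left_mono) (auto simp: remainder_const_nonneg)
    finally show ?thesis .
  qed
  ultimately have "\<bar>\<Sum>e\<in>site_pairs N. (LINT J|?P. edge_average \<nu> N r e A J) - (LINT J|?P. edge_average \<gamma> N r e A J)\<bar>
     \<le> expansion_mass r * (48 * K * ((1 + k) * ?n * R)) + 1440 * remainder_const r * K * ?n * R"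
    by linarith
  also have "\<dots> = drift_const r K * ?n * R"
    unfolding drift_const_def k_def[symmetric] by (simp add: algebra_simps)
  finally show ?thesis unfolding R_def .
qed

lemma edge_average_mixture:
  assumes g: "good_law a K \<nu>" "good_law a K \<gamma>" and u: "u \<in> {0..1}"
  shows "edge_average (mixture u \<nu> \<gamma>) N r e A J
       = u * edge_average \<nu> N r e A J + (1 - u) * edge_average \<gamma> N r e A J"
  unfolding edge_average_def
  by (rule integral_mixture[OF good_law_prob[OF g(1)] good_law_prob[OF g(2)] good_law_sets[OF g(1)]
        good_law_sets[OF g(2)] _ _ gibbs_bracket_upd_measurable gibbs_bracket_abs_le_sup_norm])
     (use u in auto)

text \<open>
  The interpolating function at \<open>q\<close> gives the coupling \<open>p\<close> the mixture with weight \<open>q p\<close>; it is affine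
  in each weight.  The drift along the diagonal is bounded by the mean squared overlap under the
  mixture, which \<open>disorder_average_comparison\<close> with two replicas, hence an exponential moment of order \<open>5\<close>,
  compares with the one under \<open>\<gamma>\<close>.
\<close>

lemma disorder_average_difference:
  assumes g: "good_law a K \<nu>" "good_law a K \<gamma>" and a: "12 * real r + 5 \<le> a" and N: "N \<ge> 1"
  shows "\<bar>disorder_average \<nu> N r A - disorder_average \<gamma> N r A\<bar>
     \<le> drift_const r K * exp (swap_const 2 K * K) * sup_norm N r A
        * (disorder_average \<gamma> N 2 (\<lambda>\<sigma>. (overlap N 1 2 \<sigma>)\<^sup>2) + 1 / real N)"
proof -
  let ?I = "site_pairs N" and ?mix = "\<lambda>u. mixture u \<nu> \<gamma>" and ?R = "\<lambda>\<sigma>. (overlap N 1 2 \<sigma>)\<^sup>2"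
  define G where "G = (\<lambda>q. hybrid_average (\<lambda>p. ?mix (q p)) N r A)"
  define B where "B = drift_const r K * exp (swap_const 2 K * K) * sup_norm N r A
        * (disorder_average \<gamma> N 2 ?R + 1 / real N)"
  have K: "0 \<le> K" using good_law_K_ge_1[OF g(1)] a by simp
  have mix: "good_law a K (?mix u)" if "u \<in> {0..1}" for u
    using that by (intro good_law_mixture[OF g]) auto
  have mix01: "?mix 0 = \<gamma>" "?mix 1 = \<nu>"
    by (simp_all add: mixture_0 mixture_1 good_law_prob[OF g(1)] good_law_prob[OF g(2)]
          good_law_sets[OF g(1)] good_law_sets[OF g(2)])
  have resample: "G (q(e := u)) = (LINT J|Pi\<^sub>M ?I (\<lambda>p. ?mix (q p)). edge_average (?mix u) N r e A J)"
    if "e \<in> ?I" "\<And>p. q p \<in> {0..1}" "u \<in> {0..1}" for e q u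
  proof -
    have "(\<lambda>p. ?mix ((q(e := u)) p)) = (\<lambda>p. ?mix (q p))(e := ?mix u)" by auto
    then show ?thesis unfolding G_def
      using hybrid_average_resample[of a K "\<lambda>p. ?mix (q p)", OF mix[OF that(2)] that(1) mix[OF that(3)]] by simp
  qed
  have aff: "G (q(e := u)) = u * G (q(e := 1)) + (1 - u) * G (q(e := 0))"
    if e: "e \<in> ?I" and q: "\<And>p. q p \<in> {0..1}" and u: "u \<in> {0..1}" for e q u
  proof -
    note i = integrable_edge_average[of a K "\<lambda>p. ?mix (q p)", OF mix[OF q] e]
    have "G (q(e := u)) = (LINT J|Pi\<^sub>M ?I (\<lambda>p. ?mix (q p)).
        u * edge_average \<nu> N r e A J + (1 - u) * edge_average \<gamma> N r e A J)"
      unfolding resample[OF that] edge_average_mixture[OF g u] ..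
    also have "\<dots> = u * G (q(e := 1)) + (1 - u) * G (q(e := 0))"
      using resample[OF e q, of 0] resample[OF e q, of 1] i[OF g(1)] i[OF g(2)] by (simp add: mix01)
    finally show ?thesis .
  qed
  have deriv: "((\<lambda>p. G (\<lambda>i. if i \<in> ?I then p else 0)) has_real_derivative
      (\<Sum>e\<in>?I. G ((\<lambda>i. if i \<in> ?I then t else 0)(e := 1)) - G ((\<lambda>i. if i \<in> ?I then t else 0)(e := 0))))
      (at t within {0..1})" if t: "t \<in> {0..1}" for t
    by (rule multiaffine_diagonal_derivative[OF finite_site_pairs t aff]) auto
  have bound: "\<bar>\<Sum>e\<in>?I. G ((\<lambda>i. if i \<in> ?I then t else 0)(e := 1)) - G ((\<lambda>i. if i \<in> ?I then t else 0)(e := 0))\<bar> \<le> B"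
    if t: "t \<in> {0..1}" for t
  proof -
    let ?q = "\<lambda>i. if i \<in> ?I then t else 0" and ?P = "Pi\<^sub>M ?I (\<lambda>_. ?mix t)"
    have PP: "Pi\<^sub>M ?I (\<lambda>p. ?mix (?q p)) = ?P" by (intro PiM_cong) auto
    have q: "?q p \<in> {0..1}" for p using t by auto
    have drift: "(\<Sum>e\<in>?I. G (?q(e := 1)) - G (?q(e := 0)))
        = (\<Sum>e\<in>?I. (LINT J|?P. edge_average \<nu> N r e A J) - (LINT J|?P. edge_average \<gamma> N r e A J))"
      using resample[OF _ q, of _ 0] resample[OF _ q, of _ 1] by (intro sum.cong refl) (simp only: PP mix01 zero_le_one atLeastAtMost_iff order_refl)
    have "\<bar>\<Sum>e\<in>?I. G (?q(e := 1)) - G (?q(e := 0))\<bar>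
        \<le> drift_const r K * sup_norm N r A * (disorder_average (?mix t) N 2 ?R + 1 / real N)"
      unfolding drift by (rule interpolation_drift_le[OF g mix[OF t] _ N]) (use a in simp)
    also have "\<dots> \<le> drift_const r K * sup_norm N r A
        * (exp (swap_const 2 K * K) * (disorder_average \<gamma> N 2 ?R + 1 / real N))"
    proof (rule mult_left_mono)
      have "disorder_average (?mix t) N 2 ?R \<le> exp (swap_const 2 K * K) * disorder_average \<gamma> N 2 ?R"
        by (rule disorder_average_comparison[OF mix[OF t] g(2) _ N]) (use a in auto)
      moreover have "1 \<le> exp (swap_const 2 K * K)"
        using K by (simp add: swap_const_def expansion_mass_nonneg remainder_const_nonneg)
      then have "1 / real N \<le> exp (swap_const 2 K * K) * (1 / real N)"
        using mult_right_mono[of 1 "exp (swap_const 2 K * K)" "1 / real N"] by simp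
      ultimately show "disorder_average (?mix t) N 2 ?R + 1 / real N
          \<le> exp (swap_const 2 K * K) * (disorder_average \<gamma> N 2 ?R + 1 / real N)"
        unfolding distrib_left by linarith
      have "0 \<le> (\<Sum>j\<le>5 * r. cavity_const (r + j) K)" by (intro sum_nonneg cavity_const_nonneg K)
      then show "0 \<le> drift_const r K * sup_norm N r A"
        using K by (simp add: drift_const_def expansion_mass_nonneg remainder_const_nonneg sup_norm_nonneg)
    qed
    also have "\<dots> = B" by (simp add: B_def mult_ac)
    finally show ?thesis .
  qed
  have "norm (G (\<lambda>i. if i \<in> ?I then 1 else 0) - G (\<lambda>i. if i \<in> ?I then 0 else 0)) \<le> B * norm (1 - 0 :: real)"
    by (rule field_differentiable_bound[where f = "\<lambda>p. G (\<lambda>i. if i \<in> ?I then p else 0)", OF _ deriv])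
       (use bound in auto)
  moreover have "G (\<lambda>i. if i \<in> ?I then 1 else 0) = disorder_average \<nu> N r A"
    "G (\<lambda>i. if i \<in> ?I then 0 else 0) = disorder_average \<gamma> N r A"
    unfolding G_def hybrid_average_const[symmetric]
    by (auto intro!: hybrid_average_cong simp: mix01)
  ultimately show ?thesis unfolding B_def by simp
qed

theorem theorem1p1:
  fixes r :: nat and b :: real
  assumes "r \<ge> 1" and "b \<ge> 1"
  shows "\<exists>C L :: real. \<forall>\<nu> :: real measure. admissible_law b \<nu> \<longrightarrow> (\<forall>N :: nat. N \<ge> 2 \<longrightarrow>
    (\<forall>A :: (nat \<Rightarrow> nat \<Rightarrow> real) \<Rightarrow> real.
        \<bar>disorder_average \<nu> N r A - disorder_average std_gaussian N r A\<bar>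
          \<le> C * sup_norm N r A *
             (disorder_average std_gaussian N 2 (\<lambda>\<sigma>. (overlap N 1 2 \<sigma>)\<^sup>2) + 1 / real N)) \<and>
    (\<forall>A :: (nat \<Rightarrow> nat \<Rightarrow> real) \<Rightarrow> real. (\<forall>\<sigma>\<in>replica_configs N r. A \<sigma> \<ge> 0) \<longrightarrow>
        exp (- L) * disorder_average std_gaussian N r A \<le> disorder_average \<nu> N r A \<and>
        disorder_average \<nu> N r A \<le> exp L * disorder_average std_gaussian N r A))"
proof -
  \<comment> \<open>The order of the exponential moment serves both \<open>interpolation_drift_le\<close> and the overlap of two replicas.\<close>
  define a where "a = 12 * real r + 5"
  define K where "K = max (exp (a * b)) (2 * exp (a\<^sup>2 / 2))"
  define C where "C = drift_const r K * exp (swap_const 2 K * K)"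
  define L where "L = swap_const r K * K"
  have gauss: "good_law a K std_gaussian"
    using good_law_gaussian by (rule good_law_mono) (simp add: K_def)
  have adm: "good_law a K \<nu>" if "admissible_law b \<nu>" for \<nu>
    using good_law_admissible[OF that, of a] by (rule good_law_mono) (simp_all add: K_def a_def)
  have i: "\<bar>disorder_average \<nu> N r A - disorder_average std_gaussian N r A\<bar>
      \<le> C * sup_norm N r A * (disorder_average std_gaussian N 2 (\<lambda>\<sigma>. (overlap N 1 2 \<sigma>)\<^sup>2) + 1 / real N)"
    if "admissible_law b \<nu>" "N \<ge> 2" for \<nu> N A
    unfolding C_def
    by (rule disorder_average_difference[OF adm[OF that(1)] gauss]) (use that in \<open>auto simp: a_def\<close>)
  have ii: "exp (- L) * disorder_average std_gaussian N r A \<le> disorder_average \<nu> N r A"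
    "disorder_average \<nu> N r A \<le> exp L * disorder_average std_gaussian N r A"
    if \<nu>: "admissible_law b \<nu>" and N: "N \<ge> 2" and A: "\<forall>\<sigma>\<in>replica_configs N r. A \<sigma> \<ge> 0" for \<nu> N A
  proof -
    have a: "2 * real r + 1 \<le> a" and N: "N \<ge> 1" using N by (auto simp: a_def)
    show "disorder_average \<nu> N r A \<le> exp L * disorder_average std_gaussian N r A"
      unfolding L_def using A by (intro disorder_average_comparison[OF adm[OF \<nu>] gauss a N]) auto
    have "disorder_average std_gaussian N r A \<le> exp L * disorder_average \<nu> N r A"
      unfolding L_def using A by (intro disorder_average_comparison[OF gauss adm[OF \<nu>] a N]) auto
    then have "exp (- L) * disorder_average std_gaussian N r A \<le> exp (- L) * (exp L * disorder_average \<nu> N r A)"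
      by (rule mult_left_mono) simp
    then show "exp (- L) * disorder_average std_gaussian N r A \<le> disorder_average \<nu> N r A"
      unfolding mult.assoc[symmetric] exp_add[symmetric] by simp
  qed
  show ?thesis using i ii by blast
qed

end
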